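(* Let $t_0\ge 0$, $m\ge1$, let $b_1,\dots,b_m:[0,\infty)\to\mathbb{R}$ be Lebesgue measurable and essentially bounded, and let $h_1,\dots,h_m$ be Lebesgue measurable on $[0,\infty)$ with constants $0\le\delta_k\le\tau_k<\infty$ such that $\delta_k\le t-h_k(t)\le\tau_k$ for $t\ge t_0$; set $\tau=\max_k\tau_k$. Let $f:[t_0,\infty)\to\mathbb{R}$ be Lebesgue measurable and locally essentially bounded, and $\phi:[t_0-\tau,t_0]\to\mathbb{R}$ bounded and Borel measurable. Consider the problem $$\dot{x}(t)+\sum_{k=1}^m b_k(t)x(h_k(t))=f(t),\ t\ge t_0;\qquad x(t)=\phi(t),\ t\le t_0.$$ Assume there are constants $\lambda>0$ and $\alpha>0$ such that $$a(t):=\sum_{k=1}^m e^{\lambda(t-h_k(t))}b_k(t)-\lambda\ge\alpha,\quad t\ge t_0,$$ and, with $a_k(t)=e^{\lambda(t-h_k(t))}b_k(t)$, $$M_1:=\Big(\lambda+\sum_{k=1}^m e^{\lambda\tau_k}\|b_k\|_{[t_0,\infty)}\Big)\sum_{k=1}^m\tau_k\Big\|\frac{a_k}{a}\Big\|_{[t_0,\infty)}<1.$$ Then, with $M_0:=(1-M_1)^{-1}$, the solution $x$ of the problem satisfies for all $t\ge t_0$ $$|x(t)|\le M_0e^{-\lambda(t-t_0)}\Big[|x(t_0)|+\sum_{k=1}^m\frac{e^{\lambda\tau_k}-1}{\lambda}\|b_k\|_{[t_0,\infty)}\|\phi\|_{[t_0-\tau,t_0]}\Big]+\frac{M_0}{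\lambda}\|f\|_{[t_0,t]}.$$
   Context: For an interval $J$, $\|g\|_J=\operatorname{ess\,sup}_{t\in J}|g(t)|$ (for $\phi$ this is the sup norm on $[t_0-\tau,t_0]$). A solution of the problem is a locally absolutely continuous function $x$ on $[t_0,\infty)$ satisfying the differential equation almost everywhere for $t\ge t_0$ and $x(t)=\phi(t)$ for $t\le t_0$ (so values $x(h_k(t))$ with $h_k(t)<t_0$ are given by $\phi$); it exists and is unique. *)

theory Defs
  imports "HOL-Analysis.Analysis"
begin

definition abs_cont_on :: "real \<Rightarrow> real \<Rightarrow> (real \<Rightarrow> real) \<Rightarrow> bool" where
  "abs_cont_on c d x \<longleftrightarrow>
     (\<forall>\<epsilon>>0. \<exists>\<delta>>0. \<forall>(n::nat) (a::nat \<Rightarrow> real) (b::nat \<Rightarrow> real).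
        (\<forall>i<n. c \<le> a i \<and> a i \<le> b i \<and> b i \<le> d) \<and>
        (\<forall>i<n. \<forall>j<n. i \<noteq> j \<longrightarrow> b i \<le> a j \<or> b j \<le> a i) \<and>
        (\<Sum>i<n. b i - a i) < \<delta>
        \<longrightarrow> (\<Sum>i<n. \<bar>x (b i) - x (a i)\<bar>) < \<epsilon>)"

definition loc_abs_cont_from :: "real \<Rightarrow> (real \<Rightarrow> real) \<Rightarrow> bool" where
  "loc_abs_cont_from t0 x \<longleftrightarrow> (\<forall>T\<ge>t0. abs_cont_on t0 T x)"

definition ess_norm :: "real set \<Rightarrow> (real \<Rightarrow> real) \<Rightarrow> real" where
  "ess_norm J g = Inf {B. 0 \<le> B \<and> (AE t in lebesgue. t \<in> J \<longrightarrow> \<bar>g t\<bar> \<le> B)}"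

definition ess_bounded_on :: "real set \<Rightarrow> (real \<Rightarrow> real) \<Rightarrow> bool" where
  "ess_bounded_on J g \<longleftrightarrow> (\<exists>B. AE t in lebesgue. t \<in> J \<longrightarrow> \<bar>g t\<bar> \<le> B)"

definition sup_norm :: "real set \<Rightarrow> (real \<Rightarrow> real) \<Rightarrow> real" where
  "sup_norm J g = (SUP t\<in>J. \<bar>g t\<bar>)"

end

(* The function y(t) = exp(lam (t - t0)) x(t), cut off to 0 before t0, solves
     y' = lam y - sum_k a_k y(h_k) + G,
   where the forcing G collects f and the contribution of phi.  Let Y be the fundamental solution
   with a unit jump at r, let K be its supremum on [r, T] and L = lam + sum_k exp(lam tau_k) |b_k|,
   so that |Y'| <= L K and a <= L.  Rewriting the equation as Y' + a Y = sum_k a_k (Y - Y(h_k)),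
   the function V(t) = 1 + sum_k |a_k/a| K L min(t - r, tau_k) is a supersolution: if h_k(t) < r,
   then |Y - Y(h_k)| <= K is absorbed by the derivative K L of the ramp, as a <= L; otherwise it is
   at most L K min(t - r, tau_k) and absorbed by a V.  Hence K <= 1 + M1 K.  The solution y is a
   superposition of fundamental solutions, so |y| <= M0 (|x(t0)| + int |G|). *)
theory Submission
  imports Defs
begin

section \<open>Absolutely continuous functions\<close>

text \<open>The equation holds only almost everywhere, and absolute continuity is given by its
  epsilon-delta form. A gauge proof of the fundamental theorem of calculus bridges this gap; from
  then on every equation is used in integrated form. The constants of the bound come from
  integrating the forcing. The initial function is felt through the k-th delay only while t < t0 +
  tau_k, and the weight exp (lam (s - t0)) integrates over that span to (exp (lam tau_k) - 1) / lam.
  Over [t0, T] the weight integrates to at most exp (lam (T - t0)) / lam, whose exponential cancels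
  on the way back to x. The detour through unit jumps protects the factor M0: after r a fundamental
  solution is unforced, so that Y - Y(h_k) is controlled by L K alone, whereas for a forced solution
  it also contains the integral of the forcing over the delay. Superposition uses finitely many
  jumps and a limit, so that no regularity of Y in r is required.\<close>

lemma abs_cont_onE:
  assumes "abs_cont_on c d x" and "0 < \<epsilon>"
  obtains \<delta> where "\<delta> > 0"
    and "\<forall>(n::nat) (a::nat \<Rightarrow> real) (b::nat \<Rightarrow> real).
        (\<forall>i<n. c \<le> a i \<and> a i \<le> b i \<and> b i \<le> d) \<and>
        (\<forall>i<n. \<forall>j<n. i \<noteq> j \<longrightarrow> b i \<le> a j \<or> b j \<le> a i) \<and>
        (\<Sum>i<n. b i - a i) < \<delta>
        \<longrightarrow> (\<Sum>i<n. \<bar>x (b i) - x (a i)\<bar>) < \<epsilon>"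
  using assms(1)[unfolded abs_cont_on_def, THEN spec, THEN mp, OF assms(2)]
  by (elim exE conjE) (rule that)

text \<open>The definition numbers its intervals by an initial segment of the naturals, while a
  tagged division is a set of pairs; an enumeration of the finite index set translates between
  them.\<close>

lemma abs_cont_on_sum_less:
  assumes ac: "\<forall>(n::nat) (a::nat \<Rightarrow> real) (b::nat \<Rightarrow> real).
        (\<forall>i<n. c \<le> a i \<and> a i \<le> b i \<and> b i \<le> d) \<and>
        (\<forall>i<n. \<forall>j<n. i \<noteq> j \<longrightarrow> b i \<le> a j \<or> b j \<le> a i) \<and>
        (\<Sum>i<n. b i - a i) < \<delta>
        \<longrightarrow> (\<Sum>i<n. \<bar>x (b i) - x (a i)\<bar>) < \<epsilon>"
    and fin: "finite P"
    and int: "\<And>i. i \<in> P \<Longrightarrow> c \<le> u i \<and> u i \<le> v i \<and> v i \<le> d"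
    and dis: "\<And>i j. i \<in> P \<Longrightarrow> j \<in> P \<Longrightarrow> i \<noteq> j \<Longrightarrow> v i \<le> u j \<or> v j \<le> u i"
    and less: "(\<Sum>i\<in>P. v i - u i) < \<delta>"
  shows "(\<Sum>i\<in>P. \<bar>x (v i) - x (u i)\<bar>) < (\<epsilon>::real)"
proof -
  obtain e where e: "bij_betw e {..<card P} P"
    using ex_bij_betw_nat_finite[OF fin] by (auto simp: atLeast0LessThan)
  have re: "(\<Sum>i\<in>P. g i) = (\<Sum>i<card P. g (e i))" for g :: "_ \<Rightarrow> real"
    using sum.reindex_bij_betw[OF e, of g] by simp
  have eP: "e i \<in> P" if "i < card P" for i
    using e that by (auto simp: bij_betw_def)
  have einj: "e i \<noteq> e j" if "i < card P" "j < card P" "i \<noteq> j" for i j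
    using e that by (auto simp: bij_betw_def inj_on_def)
  have "(\<Sum>i<card P. \<bar>x (v (e i)) - x (u (e i))\<bar>) < \<epsilon>"
    using ac[rule_format, of "card P" "\<lambda>i. u (e i)" "\<lambda>i. v (e i)"] int eP dis einj less
    by (auto simp: re)
  then show ?thesis by (simp add: re)
qed

text \<open>Off \<open>N\<close> differentiability controls the Riemann sum. On \<open>N\<close>
  nothing is known about a derivative, but tags there can be confined to an open set of small
  measure, where absolute continuity makes the increments of \<open>x\<close> small. Setting the
  integrand to zero on \<open>N\<close> leaves only these increments.\<close>

theorem abs_cont_on_has_integral:
  fixes x g :: "real \<Rightarrow> real"
  assumes cd: "c \<le> d" and ac: "abs_cont_on c d x"
    and N: "negligible N"
    and der: "\<And>t. t \<in> {c..d} - N \<Longrightarrow> (x has_real_derivative g t) (at t)"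
  shows "(g has_integral (x d - x c)) {c..d}"
proof -
  define F where "F = (\<lambda>t. if t \<in> N then 0 else g t)"
  have "(F has_integral (x d - x c)) {c..d}"
    unfolding has_integral_factor_content_real
  proof (intro allI impI)
    fix e0 :: real assume "e0 > 0"
    show "\<exists>\<gamma>. gauge \<gamma> \<and> (\<forall>p. p tagged_division_of {c..d} \<and> \<gamma> fine p \<longrightarrow>
        norm ((\<Sum>(t, K)\<in>p. measure lborel K *\<^sub>R F t) - (x d - x c)) \<le> e0 * measure lborel {c..d})"
    \<comment> \<open>The permitted error is a multiple of the content, which is zero for
      \<open>c = d\<close>, so this case needs exact equality.\<close>
    proof (cases "c = d")
      case True
      have "norm ((\<Sum>(t, K)\<in>p. measure lborel K *\<^sub>R F t) - (x d - x c)) \<le> e0 * measure lborel {c..d}"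
        if p: "p tagged_division_of {c..d}" for p
      proof -
        have "measure lborel K = 0" if "(t, K) \<in> p" for t K
          using tagged_division_ofD(3)[OF p that] tagged_division_ofD(4)[OF p that] True
          by (metis box_real(2) content_0_subset content_real_eq_0 order_refl)
        then have "(\<Sum>(t, K)\<in>p. measure lborel K *\<^sub>R F t) = 0"
          by (intro sum.neutral) auto
        then show ?thesis using True by simp
      qed
      then show ?thesis by (intro exI[of _ "\<lambda>x. UNIV"]) (auto simp: gauge_def)
    next
      case False
      with cd have cd': "c < d" by simp
      \<comment> \<open>Half of the budget \<open>e0 * (d - c)\<close> is for the tags outside
        \<open>N\<close>, half for those in \<open>N\<close>.\<close>
      define e where "e = e0 * (d - c) / 2"
      have e: "e > 0" using \<open>e0 > 0\<close> cd' by (simp add: e_def)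
      obtain \<delta> where \<delta>: "\<delta> > 0" and ac\<delta>: "\<forall>(n::nat) (a::nat \<Rightarrow> real) (b::nat \<Rightarrow> real).
        (\<forall>i<n. c \<le> a i \<and> a i \<le> b i \<and> b i \<le> d) \<and>
        (\<forall>i<n. \<forall>j<n. i \<noteq> j \<longrightarrow> b i \<le> a j \<or> b j \<le> a i) \<and>
        (\<Sum>i<n. b i - a i) < \<delta>
        \<longrightarrow> (\<Sum>i<n. \<bar>x (b i) - x (a i)\<bar>) < e"
        by (rule abs_cont_onE[OF ac e])
      have "N \<in> sets lebesgue" "emeasure lebesgue N = 0"
        using N by (auto simp: negligible_iff_null_sets null_setsD1)
      obtain T where T: "open T" "N \<subseteq> T" "T - N \<in> lmeasurable" "emeasure lebesgue (T - N) < ennreal \<delta>"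
        using sets_lebesgue_outer_open[OF \<open>N \<in> sets lebesgue\<close> \<delta>] by metis
      have "T \<in> lmeasurable"
      proof -
        have "T = (T - N) \<union> N" using T by auto
        then show ?thesis
          using T(3) N negligible_imp_measurable by (metis fmeasurable.Un)
      qed
      have "measure lebesgue T < \<delta>"
      proof -
        have "measure lebesgue T = measure lebesgue (T - N)"
          using T(2) N by (intro measure_negligible_symdiff[OF T(3)]) (simp add: Un_absorb1 Diff_Diff_Int Int_absorb1)
        also have "\<dots> < \<delta>"
          using T(3,4) \<delta> by (simp add: emeasure_eq_measure2 ennreal_less_iff)
        finally show ?thesis .
      qed
      have "\<exists>r>0. \<forall>y. \<bar>y - t\<bar> < r \<longrightarrow> \<bar>x y - x t - (y - t) * g t\<bar> \<le> (e0/2) * \<bar>y - t\<bar>"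
        if "t \<in> {c..d} - N" for t
      proof -
        have "\<forall>e>0. \<exists>d>0. \<forall>y. norm (y - t) < d \<longrightarrow> norm (x y - x t - g t * (y - t)) \<le> e * norm (y - t)"
          using der[OF that] unfolding has_field_derivative_def has_derivative_at_alt by simp
        from this[rule_format, of "e0/2"] \<open>e0 > 0\<close> show ?thesis
          by (simp add: mult.commute[of "g t"])
      qed
      then obtain r where r: "\<And>t. t \<in> {c..d} - N \<Longrightarrow> r t > 0"
        "\<And>t y. t \<in> {c..d} - N \<Longrightarrow> \<bar>y - t\<bar> < r t \<Longrightarrow> \<bar>x y - x t - (y - t) * g t\<bar> \<le> (e0/2) * \<bar>y - t\<bar>"
        by metis
      \<comment> \<open>Tags in \<open>N\<close> are confined to the small open set
        \<open>T\<close>, the others to the range of the derivative estimate; radius 1 is a default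
        outside \<open>{c..d}\<close>.\<close>
      define \<gamma> where "\<gamma> = (\<lambda>t. if t \<in> N then T else ball t (if t \<in> {c..d} then r t else 1))"
      have "gauge \<gamma>"
        unfolding gauge_def \<gamma>_def using T r(1) by auto
      have bound: "norm ((\<Sum>(t, K)\<in>p. measure lborel K *\<^sub>R F t) - (x d - x c)) \<le> e0 * measure lborel {c..d}"
        if p: "p tagged_division_of {c..d}" and fine: "\<gamma> fine p" for p
      proof -
        note pD = tagged_division_ofD[OF p]
        define w where "w = (\<lambda>(t::real, K). measure lborel K * F t - (x (Sup K) - x (Inf K)))"
        \<comment> \<open>Degenerate intervals are left out: their error \<open>w\<close> is zero,
          and only for nondegenerate ones do disjoint interiors force the order of endpoints that
          absolute continuity asks for.\<close>
        define q where "q = {tk \<in> p. fst tk \<in> N \<and> measure lborel (snd tk) \<noteq> 0}"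
        have finp: "finite p" by (rule pD(1))
        have iv: "\<exists>u v. K = {u..v} \<and> u \<le> v \<and> c \<le> u \<and> v \<le> d \<and> Inf K = u \<and> Sup K = v \<and> measure lborel K = v - u \<and> t \<in> {u..v}"
          if tk: "(t, K) \<in> p" for t K
        proof -
          obtain u v where "K = {u..v}" using pD(4)[OF tk] by auto
          moreover have "t \<in> K" "K \<subseteq> {c..d}" using pD(2,3)[OF tk] by auto
          ultimately show ?thesis by (intro exI[of _ u] exI[of _ v]) auto
        qed
        have "(\<Sum>(t, K)\<in>p. measure lborel K *\<^sub>R F t) - (x d - x c) = (\<Sum>tk\<in>p. w tk)"
          using additive_tagged_division_1[OF cd p, of x]
          by (simp add: w_def sum_subtractf case_prod_unfold)
        also have "\<bar>\<dots>\<bar> \<le> (\<Sum>tk\<in>p. \<bar>w tk\<bar>)" by (rule sum_abs)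
        also have "\<dots> = (\<Sum>tk\<in>p - q. \<bar>w tk\<bar>) + (\<Sum>tk\<in>q. \<bar>w tk\<bar>)"
          by (rule sum.subset_diff) (auto simp: q_def finp)
        also have "\<dots> \<le> e + e"
        proof (rule add_mono)
          have "\<bar>w tk\<bar> \<le> (e0/2) * measure lborel (snd tk)" if "tk \<in> p - q" for tk
          proof -
            obtain t K where tk: "tk = (t, K)" by force
            with that have tkp: "(t, K) \<in> p" by auto
            obtain u v where uv: "K = {u..v}" "u \<le> v" "c \<le> u" "v \<le> d" "Inf K = u" "Sup K = v"
              "measure lborel K = v - u" "t \<in> {u..v}" using iv[OF tkp] by auto
            show ?thesis
            proof (cases "measure lborel K = 0")
              case True then show ?thesis using uv by (simp add: tk w_def)
            next
              case False
              then have tN: "t \<notin> N" using that tk by (auto simp: q_def)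
              have t: "t \<in> {c..d} - N" using tN uv by auto
              have "K \<subseteq> ball t (r t)" using fineD[OF fine tkp] t by (simp add: \<gamma>_def)
              moreover have "u \<in> K" "v \<in> K" using uv by auto
              ultimately have "\<bar>u - t\<bar> < r t" "\<bar>v - t\<bar> < r t"
                unfolding subset_iff mem_ball dist_real_def by (auto simp: abs_minus_commute)
              then have "\<bar>x u - x t - (u - t) * g t\<bar> \<le> (e0/2) * \<bar>u - t\<bar>"
                "\<bar>x v - x t - (v - t) * g t\<bar> \<le> (e0/2) * \<bar>v - t\<bar>" using r(2)[OF t] by auto
              moreover have ut: "\<bar>u - t\<bar> = t - u" and vt: "\<bar>v - t\<bar> = v - t" using uv by auto
              moreover have "w tk = (x u - x t - (u - t) * g t) - (x v - x t - (v - t) * g t)"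
                using uv tN by (simp add: w_def tk F_def algebra_simps)
              \<comment> \<open>Straddle estimate: the tag lies between the endpoints, so the two
                one-sided errors add up to a multiple of the length.\<close>
              ultimately have "\<bar>w tk\<bar> \<le> (e0/2) * (t - u) + (e0/2) * (v - t)"
                by (simp only:)
              also have "\<dots> = (e0/2) * (v - u)" by (subst distrib_left[symmetric]) simp
              finally show ?thesis using uv by (simp add: tk)
            qed
          qed
          then have "(\<Sum>tk\<in>p - q. \<bar>w tk\<bar>) \<le> (\<Sum>tk\<in>p - q. (e0/2) * measure lborel (snd tk))"
            by (rule sum_mono)
          also have "\<dots> \<le> (\<Sum>tk\<in>p. (e0/2) * measure lborel (snd tk))"
            using \<open>e0 > 0\<close> finp by (intro sum_mono2) auto
          also have "\<dots> = (e0/2) * (\<Sum>(t,K)\<in>p. measure lborel K)"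
            by (simp add: sum_distrib_left case_prod_unfold)
          also have "(\<Sum>(t,K)\<in>p. measure lborel K) = d - c"
            using additive_content_tagged_division[of p c d] p cd by simp
          finally show "(\<Sum>tk\<in>p - q. \<bar>w tk\<bar>) \<le> e" by (simp add: e_def)
        next
          have finq: "finite q" using finp by (simp add: q_def)
          have qp: "tk \<in> p" if "tk \<in> q" for tk using that by (simp add: q_def)
          have ivq: "\<exists>u v. snd tk = {u..v} \<and> u < v \<and> c \<le> u \<and> v \<le> d \<and> Inf (snd tk) = u \<and> Sup (snd tk) = v
              \<and> measure lborel (snd tk) = v - u" if "tk \<in> q" for tk
            using iv[of "fst tk" "snd tk"] qp[OF that] that by (auto simp: q_def)
          have disj: "interior (snd i) \<inter> interior (snd j) = {}" if "i \<in> q" "j \<in> q" "i \<noteq> j" for i j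
            using pD(5)[of "fst i" "snd i" "fst j" "snd j"] qp that by auto
          have "(\<Sum>tk\<in>q. \<bar>x (Sup (snd tk)) - x (Inf (snd tk))\<bar>) < e"
          proof (rule abs_cont_on_sum_less[OF ac\<delta> finq])
            fix i j assume ij: "i \<in> q" "j \<in> q" "i \<noteq> j"
            obtain u v where 1: "snd i = {u..v}" "u < v" "Inf (snd i) = u" "Sup (snd i) = v"
              using ivq[OF ij(1)] by auto
            obtain u' v' where 2: "snd j = {u'..v'}" "u' < v'" "Inf (snd j) = u'" "Sup (snd j) = v'"
              using ivq[OF ij(2)] by auto
            have "{u<..<v} \<inter> {u'<..<v'} = {}" using disj[OF ij] 1 2 by simp
            then have "\<not> (max u u' < min v v')"
              using dense[of "max u u'" "min v v'"] by auto
            then show "Sup (snd i) \<le> Inf (snd j) \<or> Sup (snd j) \<le> Inf (snd i)"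
              using 1 2 by (auto simp: max_def min_def split: if_splits)
          next
            fix i assume "i \<in> q"
            from ivq[OF this] show "c \<le> Inf (snd i) \<and> Inf (snd i) \<le> Sup (snd i) \<and> Sup (snd i) \<le> d"
              by (elim exE conjE) (simp only: less_imp_le simp_thms)
          next
            \<comment> \<open>Interiors are genuinely disjoint, whereas the closed intervals may
              share endpoints; all lie in \<open>T\<close>, whose measure is below
              \<open>\<delta>\<close>.\<close>
            have "(\<Sum>i\<in>q. Sup (snd i) - Inf (snd i)) = (\<Sum>i\<in>q. measure lebesgue (interior (snd i)))"
            proof (rule sum.cong)
              fix i assume "i \<in> q"
              then obtain u v where "snd i = {u..v}" "u < v" using ivq by blast
              then show "Sup (snd i) - Inf (snd i) = measure lebesgue (interior (snd i))" by simp
            qed simp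
            also have "\<dots> = measure lebesgue (\<Union>i\<in>q. interior (snd i))"
            proof (rule measure_finite_Union[symmetric, OF finq])
              show "disjoint_family_on (\<lambda>i. interior (snd i)) q" using disj by (auto simp: disjoint_family_on_def)
              fix i assume "i \<in> q"
              then obtain u v where "snd i = {u..v}" "u < v" using ivq by blast
              then show "emeasure lebesgue (interior (snd i)) \<noteq> \<infinity>" by simp
            qed auto
            also have "\<dots> \<le> measure lebesgue T"
            proof (rule measure_mono_fmeasurable)
              have "snd i \<subseteq> T" if "i \<in> q" for i
                using fineD[OF fine, of "fst i" "snd i"] that by (simp add: q_def \<gamma>_def)
              then show "(\<Union>i\<in>q. interior (snd i)) \<subseteq> T"
                by (intro UN_least order_trans[OF interior_subset])
              show "(\<Union>i\<in>q. interior (snd i)) \<in> sets lebesgue"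
                by (intro sets.finite_UN finq) simp
            qed (use \<open>T \<in> lmeasurable\<close> in auto)
            finally show "(\<Sum>i\<in>q. Sup (snd i) - Inf (snd i)) < \<delta>"
              using \<open>measure lebesgue T < \<delta>\<close> by simp
          qed
          moreover have "\<bar>w tk\<bar> = \<bar>x (Sup (snd tk)) - x (Inf (snd tk))\<bar>" if "tk \<in> q" for tk
            using that by (auto simp: w_def q_def F_def case_prod_unfold)
          ultimately show "(\<Sum>tk\<in>q. \<bar>w tk\<bar>) \<le> e" by simp
        qed
        also have "e + e = e0 * measure lborel {c..d}" using cd by (simp add: e_def)
        finally show ?thesis by simp
      qed
      show ?thesis
      proof (intro exI[of _ \<gamma>] conjI allI impI)
        show "gauge \<gamma>" by fact
      qed (elim conjE, rule bound)
    qed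
  qed
  then show ?thesis
    by (rule has_integral_spike[OF N, rotated]) (auto simp: F_def)
qed

lemma abs_cont_on_imp_continuous_on:
  assumes "abs_cont_on c d x"
  shows "continuous_on {c..d} x"
  unfolding continuous_on_iff
proof (intro ballI allI impI)
  fix t and e :: real assume t: "t \<in> {c..d}" and "e > 0"
  obtain \<delta> where "\<delta> > 0" and \<delta>: "\<forall>(n::nat) (a::nat \<Rightarrow> real) (b::nat \<Rightarrow> real).
        (\<forall>i<n. c \<le> a i \<and> a i \<le> b i \<and> b i \<le> d) \<and>
        (\<forall>i<n. \<forall>j<n. i \<noteq> j \<longrightarrow> b i \<le> a j \<or> b j \<le> a i) \<and>
        (\<Sum>i<n. b i - a i) < \<delta>
        \<longrightarrow> (\<Sum>i<n. \<bar>x (b i) - x (a i)\<bar>) < e"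
    by (rule abs_cont_onE[OF assms \<open>e > 0\<close>])
  have "dist (x s) (x t) < e" if "s \<in> {c..d}" "dist s t < \<delta>" for s
    using \<delta>[THEN spec, THEN spec, THEN spec, of 1 "\<lambda>_. min s t" "\<lambda>_. max s t"] t that
    by (auto simp: dist_real_def min_def max_def abs_minus_commute split: if_splits)
  then show "\<exists>\<delta>>0. \<forall>s\<in>{c..d}. dist s t < \<delta> \<longrightarrow> dist (x s) (x t) < e"
    using \<open>\<delta> > 0\<close> by blast
qed

text \<open>The increment of the product splits into \<open>E (b i)\<close> times the increment of
  \<open>x\<close> plus the increment of \<open>E\<close> times \<open>x (a i)\<close>; both factors
  are bounded on the compact interval, and each half receives \<open>e / 2\<close>.\<close>

lemma abs_cont_on_mult_lipschitz:
  assumes x: "abs_cont_on c d x"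
    and lip: "\<And>s t. c \<le> s \<Longrightarrow> s \<le> t \<Longrightarrow> t \<le> d \<Longrightarrow> \<bar>E t - E s\<bar> \<le> C * (t - s)"
  shows "abs_cont_on c d (\<lambda>t. E t * x t)"
proof -
  have "continuous_on {c..d} x" by (rule abs_cont_on_imp_continuous_on[OF x])
  then have "bounded (x ` {c..d})"
    by (intro compact_imp_bounded compact_continuous_image) auto
  then obtain X where X: "X > 0" "\<And>t. t \<in> {c..d} \<Longrightarrow> \<bar>x t\<bar> \<le> X"
    unfolding bounded_pos by auto
  define M where "M = 1 + \<bar>E d\<bar> + \<bar>C\<bar> * \<bar>d - c\<bar>"
  have M: "M > 0" "\<bar>E t\<bar> \<le> M" if "t \<in> {c..d}" for t
  proof -
    have "\<bar>E d - E t\<bar> \<le> C * (d - t)" using lip[of t d] that by auto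
    also have "\<dots> \<le> \<bar>C\<bar> * \<bar>d - c\<bar>" using that by (intro mult_mono) auto
    finally show "\<bar>E t\<bar> \<le> M" by (simp add: M_def)
  qed (simp add: M_def add_pos_nonneg)
  show ?thesis
  proof (cases "c \<le> d")
    \<comment> \<open>With \<open>c > d\<close> only the empty family is admissible, so any
      tolerance works.\<close>
    case False
    then have "\<not> (\<forall>i<n. c \<le> a i \<and> a i \<le> b i \<and> b i \<le> d)" if "n \<noteq> 0" for n :: nat and a b :: "nat \<Rightarrow> real"
      using that by force
    then show ?thesis unfolding abs_cont_on_def
      by (metis (no_types, lifting) lessThan_0 sum.empty zero_less_one)
  next
    case True
    then have M0: "M > 0" using M(1)[of c] by auto
    show ?thesis unfolding abs_cont_on_def
    proof (intro allI impI)
      fix e :: real assume e: "e > 0"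
      have "e / (2 * M) > 0" using e M0 by simp
      obtain \<delta> where \<delta>: "\<delta> > 0" and \<delta>x: "\<forall>(n::nat) (a::nat \<Rightarrow> real) (b::nat \<Rightarrow> real).
        (\<forall>i<n. c \<le> a i \<and> a i \<le> b i \<and> b i \<le> d) \<and>
        (\<forall>i<n. \<forall>j<n. i \<noteq> j \<longrightarrow> b i \<le> a j \<or> b j \<le> a i) \<and>
        (\<Sum>i<n. b i - a i) < \<delta>
        \<longrightarrow> (\<Sum>i<n. \<bar>x (b i) - x (a i)\<bar>) < e / (2 * M)"
        by (rule abs_cont_onE[OF x \<open>e / (2 * M) > 0\<close>])
      \<comment> \<open>The second entry makes the Lipschitz half at most \<open>e / 2\<close>; the
        \<open>+ 1\<close> keeps the denominator positive even for \<open>C = 0\<close>.\<close>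
      define \<eta> where "\<eta> = min \<delta> (e / (2 * X * (\<bar>C\<bar> + 1)))"
      have "\<eta> > 0" using \<delta> e X by (simp add: \<eta>_def)
      moreover have "(\<Sum>i<n. \<bar>E (b i) * x (b i) - E (a i) * x (a i)\<bar>) < e"
        if h: "(\<forall>i<n. c \<le> a i \<and> a i \<le> b i \<and> b i \<le> d) \<and>
        (\<forall>i<n. \<forall>j<n. i \<noteq> j \<longrightarrow> b i \<le> a j \<or> b j \<le> a i) \<and> (\<Sum>i<n. b i - a i) < \<eta>" for n :: nat and a b
      proof -
        have "(\<Sum>i<n. \<bar>E (b i) * x (b i) - E (a i) * x (a i)\<bar>)
           \<le> (\<Sum>i<n. M * \<bar>x (b i) - x (a i)\<bar> + X * (\<bar>C\<bar> + 1) * (b i - a i))"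
        proof (rule sum_mono)
          fix i assume "i \<in> {..<n}"
          then have i: "c \<le> a i" "a i \<le> b i" "b i \<le> d" using h by auto
          have "\<bar>E (b i) * x (b i) - E (a i) * x (a i)\<bar>
             = \<bar>E (b i) * (x (b i) - x (a i)) + (E (b i) - E (a i)) * x (a i)\<bar>" by (simp add: algebra_simps)
          also have "\<dots> \<le> \<bar>E (b i)\<bar> * \<bar>x (b i) - x (a i)\<bar> + \<bar>E (b i) - E (a i)\<bar> * \<bar>x (a i)\<bar>"
            by (metis abs_mult abs_triangle_ineq)
          also have "\<dots> \<le> M * \<bar>x (b i) - x (a i)\<bar> + (\<bar>C\<bar> + 1) * (b i - a i) * X"
          proof (intro add_mono mult_mono)
            have "C * (b i - a i) \<le> (\<bar>C\<bar> + 1) * (b i - a i)" using i by (intro mult_right_mono) auto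
            then show "\<bar>E (b i) - E (a i)\<bar> \<le> (\<bar>C\<bar> + 1) * (b i - a i)" using lip[of "a i" "b i"] i by linarith
          qed (use i M X M0 in auto)
          finally show "\<bar>E (b i) * x (b i) - E (a i) * x (a i)\<bar> \<le> M * \<bar>x (b i) - x (a i)\<bar> + X * (\<bar>C\<bar> + 1) * (b i - a i)"
            by (simp add: algebra_simps)
        qed
        also have "\<dots> = M * (\<Sum>i<n. \<bar>x (b i) - x (a i)\<bar>) + X * (\<bar>C\<bar> + 1) * (\<Sum>i<n. b i - a i)"
          by (simp add: sum.distrib sum_distrib_left)
        also have "\<dots> < M * (e / (2 * M)) + X * (\<bar>C\<bar> + 1) * (e / (2 * X * (\<bar>C\<bar> + 1)))"
        proof (rule add_strict_mono)
          show "M * (\<Sum>i<n. \<bar>x (b i) - x (a i)\<bar>) < M * (e / (2 * M))"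
            using h \<delta>x[THEN spec, THEN spec, THEN spec, of n a b] M0 by (intro mult_strict_left_mono) (auto simp: \<eta>_def)
          show "X * (\<bar>C\<bar> + 1) * (\<Sum>i<n. b i - a i) < X * (\<bar>C\<bar> + 1) * (e / (2 * X * (\<bar>C\<bar> + 1)))"
            using h X(1) by (intro mult_strict_left_mono) (auto simp: \<eta>_def add_nonneg_pos)
        qed
        also have "\<dots> = e"
        proof -
          have "M * (e / (2 * M)) = e / 2" using M0 by simp
          moreover have "X * (\<bar>C\<bar> + 1) * (e / (2 * X * (\<bar>C\<bar> + 1))) = e / 2"
          proof -
            have "q * (e / (2 * q)) = e / 2" if "q > 0" for q :: real using that by simp
            from this[of "X * (\<bar>C\<bar> + 1)"] show ?thesis
              using X(1) by (simp only: mult.assoc) simp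
          qed
          ultimately show ?thesis by simp
        qed
        finally show ?thesis .
      qed
      ultimately show "\<exists>\<delta>>0. \<forall>(n::nat) a b. (\<forall>i<n. c \<le> a i \<and> a i \<le> b i \<and> b i \<le> d) \<and>
        (\<forall>i<n. \<forall>j<n. i \<noteq> j \<longrightarrow> b i \<le> a j \<or> b j \<le> a i) \<and> (\<Sum>i<n. b i - a i) < \<delta> \<longrightarrow>
        (\<Sum>i<n. \<bar>E (b i) * x (b i) - E (a i) * x (a i)\<bar>) < e" by blast
    qed
  qed
qed

section \<open>Linear delay equations and their fundamental solutions\<close>

lemma continuous_on_atLeast:
  fixes F :: "real \<Rightarrow> real"
  assumes "\<And>T. continuous_on {r..T} F"
  shows "continuous_on {r..} F"
  unfolding continuous_on_iff
proof (intro ballI allI impI)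
  fix t e :: real assume t: "t \<in> {r..}" and "e > 0"
  then obtain d where d: "d > 0" "\<And>s. s \<in> {r..t+1} \<Longrightarrow> dist s t < d \<Longrightarrow> dist (F s) (F t) < e"
    using assms[of "t + 1", unfolded continuous_on_iff, rule_format, of t e] by auto
  have "dist (F s) (F t) < e" if "s \<in> {r..}" "dist s t < min d 1" for s
    using d(2)[of s] that by (auto simp: dist_real_def)
  then show "\<exists>d>0. \<forall>s\<in>{r..}. dist s t < d \<longrightarrow> dist (F s) (F t) < e"
    using d(1) by (intro exI[of _ "min d 1"]) auto
qed

lemma measurable_if_continuous_from:
  fixes Y :: "real \<Rightarrow> real"
  assumes "continuous_on {r..} Y" "\<And>t. t < r \<Longrightarrow> Y t = 0"
  shows "Y \<in> borel_measurable borel"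
proof -
  have "(\<lambda>t. if t \<in> {r..} then Y t else 0) \<in> borel_measurable borel"
    by (rule borel_measurable_continuous_on_if) (use assms in auto)
  moreover have "(\<lambda>t. if t \<in> {r..} then Y t else 0) = Y"
    using assms(2) by force
  ultimately show ?thesis by simp
qed

lemma bounded_measurable_integrable:
  fixes g :: "real \<Rightarrow> real"
  assumes "g \<in> borel_measurable lebesgue" and "\<And>s. s \<in> {r..t} \<Longrightarrow> \<bar>g s\<bar> \<le> K"
  shows "g integrable_on {r..t}"
proof (rule measurable_bounded_by_integrable_imp_integrable_real[where g = "\<lambda>_. K"])
  show "g \<in> borel_measurable (lebesgue_on {r..t})"
    using assms(1) by (rule measurable_restrict_space1)
qed (use assms(2) in auto)

text \<open>The coefficients \<open>c\<close> are those after the exponential weight has been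
  absorbed. All bounds are pointwise and on the whole line, so that null sets need no attention
  here; \<open>p k\<close> stands for the norm of the quotient of \<open>c k\<close> by the net
  coefficient, with the positive denominator multiplied out in \<open>ratio\<close>.\<close>

locale delay_system =
  fixes I :: "nat set" and c h :: "nat \<Rightarrow> real \<Rightarrow> real"
    and B \<tau> p :: "nat \<Rightarrow> real" and lam :: real
  assumes finite_I: "finite I" and lam: "lam > 0"
    and c_meas: "\<And>k. k \<in> I \<Longrightarrow> c k \<in> borel_measurable lebesgue"
    and h_meas: "\<And>k. k \<in> I \<Longrightarrow> h k \<in> borel_measurable lebesgue"
    and c_bound: "\<And>k s. k \<in> I \<Longrightarrow> \<bar>c k s\<bar> \<le> B k"
    and delay: "\<And>k s. k \<in> I \<Longrightarrow> s - \<tau> k \<le> h k s \<and> h k s \<le> s"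
    and dominated: "\<And>s. lam < (\<Sum>k\<in>I. c k s)"
    and ratio: "\<And>k s. k \<in> I \<Longrightarrow> \<bar>c k s\<bar> \<le> p k * ((\<Sum>j\<in>I. c j s) - lam)"
begin

definition rhs :: "(real \<Rightarrow> real) \<Rightarrow> real \<Rightarrow> real" where
  "rhs z s = lam * z s - (\<Sum>k\<in>I. c k s * z (h k s))"

definition L :: real where "L = lam + (\<Sum>k\<in>I. B k)"

definition M1 :: real where "M1 = L * (\<Sum>k\<in>I. \<tau> k * p k)"

lemma B_nonneg: "k \<in> I \<Longrightarrow> 0 \<le> B k"
  using c_bound[of k 0] by linarith

lemma tau_nonneg: "k \<in> I \<Longrightarrow> 0 \<le> \<tau> k"
  using delay[of k 0] by linarith

lemma p_nonneg: "k \<in> I \<Longrightarrow> 0 \<le> p k"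
  using ratio[of k 0] dominated[of 0]
  by (smt (verit, best) mult_neg_pos)

lemma L_pos: "L > 0"
  unfolding L_def using lam by (intro add_pos_nonneg sum_nonneg B_nonneg) auto

lemma rhs_measurable:
  assumes "z \<in> borel_measurable borel"
  shows "rhs z \<in> borel_measurable lebesgue"
proof -
  have "z \<in> borel_measurable lebesgue"
    using assms borel_measurable_subalgebra[of borel lebesgue z]
    by (simp add: measurable_completion)
  \<comment> \<open>The delays are only Lebesgue measurable, so the outer function \<open>z\<close>
    must be Borel for the composition to be measurable.\<close>
  moreover have "(\<lambda>s. z (h k s)) \<in> borel_measurable lebesgue" if "k \<in> I" for k
    by (rule measurable_compose[OF h_meas[OF that] assms])
  ultimately show ?thesis
    unfolding rhs_def[abs_def] using c_meas by measurable
qed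

lemma rhs_bound:
  assumes "\<And>u. u \<le> s \<Longrightarrow> \<bar>z u\<bar> \<le> K"
  shows "\<bar>rhs z s\<bar> \<le> L * K"
proof -
  have "\<bar>rhs z s\<bar> \<le> \<bar>lam * z s\<bar> + \<bar>\<Sum>k\<in>I. c k s * z (h k s)\<bar>"
    unfolding rhs_def by (rule abs_triangle_ineq4)
  also have "\<dots> \<le> lam * K + (\<Sum>k\<in>I. B k * K)"
  proof (rule add_mono)
    show "\<bar>lam * z s\<bar> \<le> lam * K"
      using assms[of s] lam by (simp add: abs_mult)
    have "\<bar>\<Sum>k\<in>I. c k s * z (h k s)\<bar> \<le> (\<Sum>k\<in>I. \<bar>c k s * z (h k s)\<bar>)" by (rule sum_abs)
    also have "\<dots> \<le> (\<Sum>k\<in>I. B k * K)"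
      unfolding abs_mult
      by (intro sum_mono mult_mono c_bound assms B_nonneg) (use delay in auto)
    finally show "\<bar>\<Sum>k\<in>I. c k s * z (h k s)\<bar> \<le> (\<Sum>k\<in>I. B k * K)" .
  qed
  also have "\<dots> = L * K" by (simp add: L_def distrib_right flip: sum_distrib_right)
  finally show ?thesis .
qed

lemma rhs_diff: "rhs (\<lambda>t. z t - z' t) s = rhs z s - rhs z' s"
  by (simp add: rhs_def algebra_simps sum_subtractf)

lemma rhs_scale: "rhs (\<lambda>t. C * z t) s = C * rhs z s"
  by (simp add: rhs_def algebra_simps sum_distrib_left)

lemma rhs_sum: "rhs (\<lambda>t. \<Sum>i\<in>J. z i t) s = (\<Sum>i\<in>J. rhs (z i) s)"
proof -
  have "(\<Sum>k\<in>I. c k s * (\<Sum>i\<in>J. z i (h k s))) = (\<Sum>i\<in>J. \<Sum>k\<in>I. c k s * z i (h k s))"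
    by (simp add: sum_distrib_left sum.swap[of _ I])
  then show ?thesis by (simp add: rhs_def sum_subtractf sum_distrib_left)
qed

lemma rhs_integrable:
  assumes "z \<in> borel_measurable borel" and "\<And>u. u \<le> t \<Longrightarrow> \<bar>z u\<bar> \<le> K"
  shows "rhs z integrable_on {r..t}"
proof (rule bounded_measurable_integrable[OF rhs_measurable[OF assms(1)]])
  fix s assume "s \<in> {r..t}"
  then show "\<bar>rhs z s\<bar> \<le> L * K" by (intro rhs_bound assms(2)) auto
qed

text \<open>Against the weight \<open>exp (2 * L * t)\<close> the integral operator is a contraction with factor
  one half; this gives both existence and the stability estimate.\<close>

lemma integral_rhs_weighted:
  assumes z: "z \<in> borel_measurable borel"
    and K: "\<And>u. u \<le> t \<Longrightarrow> \<bar>z u\<bar> \<le> K * exp (2 * L * (u - r))" and "K \<ge> 0" and rt: "r \<le> t"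
  shows "rhs z integrable_on {r..t}"
    and "\<bar>integral {r..t} (rhs z)\<bar> \<le> K / 2 * exp (2 * L * (t - r))"
proof -
  have mono: "K * exp (2 * L * (u - r)) \<le> K * exp (2 * L * (s - r))" if "u \<le> s" for u s
    using that L_pos \<open>K \<ge> 0\<close> by (intro mult_left_mono) auto
  show int: "rhs z integrable_on {r..t}"
  proof (rule rhs_integrable[OF z])
    show "\<bar>z u\<bar> \<le> K * exp (2 * L * (t - r))" if "u \<le> t" for u
      using K[OF that] mono[OF that] by linarith
  qed
  \<comment> \<open>Integrating \<open>L * (K * exp (2 * L * (s - r)))\<close> divides by
    \<open>2 * L\<close>, which is the origin of the factor one half.\<close>
  define F where "F = (\<lambda>s. K / 2 * exp (2 * L * (s - r)))"
  have F: "((\<lambda>s. L * (K * exp (2 * L * (s - r)))) has_integral (F t - F r)) {r..t}"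
  proof (rule fundamental_theorem_of_calculus[OF rt])
    fix s assume "s \<in> {r..t}"
    show "(F has_vector_derivative L * (K * exp (2 * L * (s - r)))) (at s within {r..t})"
      unfolding F_def has_real_derivative_iff_has_vector_derivative[symmetric]
      by (auto intro!: derivative_eq_intros)
  qed
  have "norm (integral {r..t} (rhs z)) \<le> integral {r..t} (\<lambda>s. L * (K * exp (2 * L * (s - r))))"
  proof (rule Henstock_Kurzweil_Integration.integral_norm_bound_integral[OF int])
    show "(\<lambda>s. L * (K * exp (2 * L * (s - r)))) integrable_on {r..t}" using F by blast
    fix s assume s: "s \<in> {r..t}"
    have "\<bar>z u\<bar> \<le> K * exp (2 * L * (s - r))" if "u \<le> s" for u
      using K[of u] mono[OF that] s that by fastforce
    then show "norm (rhs z s) \<le> L * (K * exp (2 * L * (s - r)))"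
      using rhs_bound by simp
  qed
  also have "\<dots> = F t - F r" using F by (rule integral_unique)
  also have "\<dots> \<le> F t" using \<open>K \<ge> 0\<close> by (simp add: F_def)
  finally show "\<bar>integral {r..t} (rhs z)\<bar> \<le> K / 2 * exp (2 * L * (t - r))"
    by (simp add: F_def)
qed

text \<open>A Gronwall-type bound for functions that satisfy the equation up to a defect
  \<open>\<epsilon>\<close>: in the weighted norm the integral is at most half the supremum
  \<open>S\<close>, whence \<open>S \<le> \<epsilon> + S / 2\<close>. The a priori bound
  \<open>K\<close> makes \<open>S\<close> finite, so that \<open>S / 2\<close> may be
  absorbed.\<close>

lemma stability:
  assumes z: "z \<in> borel_measurable borel" and zero: "\<And>t. t < r \<Longrightarrow> z t = 0"
    and bdd: "\<And>t. t \<le> T \<Longrightarrow> \<bar>z t\<bar> \<le> K"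
    and le: "\<And>t. r \<le> t \<Longrightarrow> t \<le> T \<Longrightarrow> \<bar>z t\<bar> \<le> \<epsilon> + \<bar>integral {r..t} (rhs z)\<bar>"
    and t: "r \<le> t" "t \<le> T"
  shows "\<bar>z t\<bar> \<le> 2 * \<epsilon> * exp (2 * L * (t - r))"
proof -
  define w where "w = (\<lambda>t. \<bar>z t\<bar> * exp (- 2 * L * (t - r)))"
  define S where "S = (SUP t\<in>{r..T}. w t)"
  have wK: "w t \<le> K" if "t \<in> {r..T}" for t
  proof -
    have "w t \<le> K * 1" unfolding w_def using bdd[of t] that L_pos by (intro mult_mono) auto
    then show ?thesis by simp
  qed
  then have wS: "w t \<le> S" if "t \<in> {r..T}" for t
    unfolding S_def using that by (intro cSUP_upper bdd_aboveI2) auto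
  have w0: "0 \<le> w t" for t by (simp add: w_def)
  have S0: "S \<ge> 0" using wS[of t] w0[of t] t by auto
  have eq: "\<bar>z t\<bar> = w t * exp (2 * L * (t - r))" for t
    by (simp add: w_def mult.assoc flip: exp_add)
  have zS: "\<bar>z u\<bar> \<le> S * exp (2 * L * (u - r))" if "u \<le> T" for u
  proof (cases "u < r")
    case True then show ?thesis using zero S0 by simp
  next
    case False then show ?thesis unfolding eq using wS[of u] that by simp
  qed
  have "w t \<le> \<epsilon> + S / 2" if "t \<in> {r..T}" for t
  proof -
    have "\<bar>z t\<bar> \<le> \<epsilon> + S / 2 * exp (2 * L * (t - r))"
      using le[of t] integral_rhs_weighted(2)[OF z _ S0, of t r] zS that by force
    then have "w t \<le> (\<epsilon> + S / 2 * exp (2 * L * (t - r))) * exp (- 2 * L * (t - r))"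
      unfolding w_def by (intro mult_right_mono) auto
    also have "\<dots> = \<epsilon> * exp (- 2 * L * (t - r)) + S / 2"
      by (simp add: algebra_simps flip: exp_add)
    also have "\<dots> \<le> \<epsilon> + S / 2"
    proof -
      \<comment> \<open>At the left endpoint the integral vanishes, so \<open>le\<close> itself
        forces the sign of \<open>\<epsilon>\<close>.\<close>
      have "0 \<le> \<epsilon>" using le[of r] that zero by (simp add: order_trans[OF abs_ge_zero])
      then show ?thesis using that L_pos by (simp add: mult_left_le)
    qed
    finally show ?thesis .
  qed
  then have "S \<le> \<epsilon> + S / 2"
    unfolding S_def[symmetric] using t by (subst S_def, intro cSUP_least) auto
  then have "S \<le> 2 * \<epsilon>" by simp
  then show ?thesis
    using zS[of t] t by (meson exp_ge_zero mult_right_mono order_trans)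
qed

text \<open>Stated as an integral equation, so that continuity and integrability suffice and
  \<open>Y\<close> need not be differentiated. The constant 1 against the value zero before
  \<open>r\<close> is the unit jump.\<close>

definition fundamental :: "real \<Rightarrow> (real \<Rightarrow> real) \<Rightarrow> bool" where
  "fundamental r Y \<longleftrightarrow> (\<forall>t<r. Y t = 0) \<and> continuous_on {r..} Y \<and>
     (\<forall>t\<ge>r. Y t = 1 + integral {r..t} (rhs Y))"

lemma fundamental_measurable: "fundamental r Y \<Longrightarrow> Y \<in> borel_measurable borel"
  unfolding fundamental_def by (rule measurable_if_continuous_from[of r]) auto

lemma fundamental_bounded:
  assumes "fundamental r Y"
  obtains K where "\<And>t. t \<le> T \<Longrightarrow> \<bar>Y t\<bar> \<le> K"
proof -
  have "continuous_on {r..T} Y" using assms unfolding fundamental_def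
    by (auto intro: continuous_on_subset)
  then have "bounded (Y ` {r..T})"
    by (intro compact_imp_bounded compact_continuous_image) auto
  then obtain K where K: "K > 0" "\<And>t. t \<in> {r..T} \<Longrightarrow> \<bar>Y t\<bar> \<le> K" unfolding bounded_pos by auto
  have "\<bar>Y t\<bar> \<le> K" if "t \<le> T" for t
  proof (cases "t < r")
    case True then have "Y t = 0" using assms by (simp add: fundamental_def)
    then show ?thesis using K by simp
  next
    case False then show ?thesis using K(2)[of t] that by simp
  qed
  then show ?thesis by (rule that)
qed

text \<open>Banach's fixed point theorem in the bounded continuous functions. The unknown
  \<open>w\<close> is the solution divided by \<open>exp (2 * L * (t - r))\<close>: its sup norm is
  the weighted norm, and one contraction covers the whole half line without continuation from
  interval to interval.\<close>

lemma fundamental_exists: "\<exists>Y. fundamental r Y"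
proof -
  define y :: "(real \<Rightarrow>\<^sub>C real) \<Rightarrow> real \<Rightarrow> real" where
    "y w t = (if t < r then 0 else exp (2 * L * (t - r)) * apply_bcontfun w t)" for w t
  have ycont: "continuous_on {r..} (y w)" for w
  proof -
    have "continuous_on {r..} (apply_bcontfun w)"
      by (rule continuous_on_apply_bcontfun)
    then have "continuous_on {r..} (\<lambda>t. exp (2 * L * (t - r)) * apply_bcontfun w t)"
      by (intro continuous_intros)
    then show ?thesis
      by (rule continuous_on_eq) (auto simp: y_def)
  qed
  define \<Phi>0 where "\<Phi>0 w t = exp (- 2 * L * (t - r)) * (1 + integral {r..t} (rhs (y w)))" for w t
  \<comment> \<open>Constant extension to the left of \<open>r\<close> keeps the image continuous on
    the whole line, as the type of bounded continuous functions demands; \<open>y\<close> discards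
    these values.\<close>
  define \<Phi> where "\<Phi> w t = \<Phi>0 w (max r t)" for w t
  have ym: "y w \<in> borel_measurable borel" for w
    by (rule measurable_if_continuous_from[OF ycont]) (simp add: y_def)
  have yb: "\<bar>y w t\<bar> \<le> norm w * exp (2 * L * (t - r))" for w t
    using norm_bounded[of w t] by (auto simp: y_def abs_mult mult.commute)
  note int = integral_rhs_weighted(1)[OF ym yb norm_ge_zero]
  have cont: "continuous_on {r..} (\<Phi>0 w)" for w
  proof -
    have "continuous_on {r..T} (\<Phi>0 w)" for T
    proof (cases "r \<le> T")
      case True
      then show ?thesis unfolding \<Phi>0_def
        by (intro continuous_intros indefinite_integral_continuous_1 int)
    qed auto
    then show ?thesis by (rule continuous_on_atLeast)
  qed
  have bnd: "\<bar>\<Phi>0 w t\<bar> \<le> 1 + norm w / 2" if "r \<le> t" for w t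
  proof -
    have "\<bar>\<Phi>0 w t\<bar> \<le> exp (- 2 * L * (t - r)) * (1 + norm w / 2 * exp (2 * L * (t - r)))"
      unfolding \<Phi>0_def abs_mult
    proof (intro mult_mono)
      show "\<bar>1 + integral {r..t} (rhs (y w))\<bar> \<le> 1 + norm w / 2 * exp (2 * L * (t - r))"
        using integral_rhs_weighted(2)[OF ym yb norm_ge_zero that, of w] by linarith
    qed auto
    also have "\<dots> = exp (- 2 * L * (t - r)) + norm w / 2"
      by (simp add: algebra_simps flip: exp_add)
    also have "\<dots> \<le> 1 + norm w / 2" using that L_pos by simp
    finally show ?thesis .
  qed
  have bc: "\<Phi> w \<in> bcontfun" for w
  proof (rule bcontfun_normI)
    show "continuous_on UNIV (\<Phi> w)"
      unfolding \<Phi>_def by (rule continuous_on_compose2[OF cont]) (auto intro!: continuous_intros)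
    show "norm (\<Phi> w t) \<le> 1 + norm w / 2" for t using bnd by (simp add: \<Phi>_def)
  qed
  define \<Psi> where "\<Psi> w = Bcontfun (\<Phi> w)" for w
  have \<Psi>: "apply_bcontfun (\<Psi> w) = \<Phi> w" for w
    unfolding \<Psi>_def using bc by (simp add: Bcontfun_inverse)
  have "dist (\<Psi> v) (\<Psi> w) \<le> 1/2 * dist v w" for v w
  proof (rule dist_bound)
    fix t
    define s where "s = max r t"
    have s: "r \<le> s" by (simp add: s_def)
    \<comment> \<open>By linearity the constant 1 cancels, and the contraction property becomes the
      weighted estimate for the single function \<open>v - w\<close>.\<close>
    have yd: "(\<lambda>u. y v u - y w u) = y (v - w)" by (auto simp: y_def algebra_simps)
    have "integral {r..s} (rhs (y v)) - integral {r..s} (rhs (y w)) = integral {r..s} (rhs (y (v - w)))"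
      by (simp add: integral_diff[OF int int, OF s s, symmetric] rhs_diff[symmetric] yd)
    then have "\<Phi>0 v s - \<Phi>0 w s = exp (- 2 * L * (s - r)) * integral {r..s} (rhs (y (v - w)))"
      by (simp add: \<Phi>0_def algebra_simps)
    then have "\<bar>\<Phi>0 v s - \<Phi>0 w s\<bar> \<le> exp (- 2 * L * (s - r)) * (norm (v - w) / 2 * exp (2 * L * (s - r)))"
      using integral_rhs_weighted(2)[OF ym yb norm_ge_zero s, of "v - w"] by (simp add: abs_mult)
    also have "\<dots> = norm (v - w) / 2"
      by (simp add: algebra_simps flip: exp_add)
    finally show "dist (apply_bcontfun (\<Psi> v) t) (apply_bcontfun (\<Psi> w) t) \<le> 1/2 * dist v w"
      by (simp add: \<Psi> \<Phi>_def s_def dist_norm)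
  qed
  then obtain w where w: "\<Psi> w = w"
    using banach_fix_type[of "1/2" \<Psi>] by auto
  have wt: "apply_bcontfun w t = \<Phi>0 w t" if "r \<le> t" for t
    using \<Psi>[of w] that unfolding w by (simp add: \<Phi>_def max_absorb2)
  have yeq: "y w t = 1 + integral {r..t} (rhs (y w))" if "r \<le> t" for t
    using that by (simp add: y_def wt \<Phi>0_def flip: exp_add mult.assoc)
  have "fundamental r (y w)"
    unfolding fundamental_def using yeq ycont by (auto simp: y_def)
  then show ?thesis by blast
qed

end

text \<open>If \<open>W t < 0\<close>, let \<open>s\<close> be the last point before
  \<open>t\<close> with \<open>0 \<le> W s\<close>. Then \<open>W\<close> is nonpositive on
  \<open>{s..t}\<close>, and \<open>mono\<close> gives \<open>0 \<le> W s \<le> W t\<close>, a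
  contradiction. The differential inequality enters as a statement about increments because it is
  available only in integrated form.\<close>

lemma nonneg_by_comparison:
  fixes W :: "real \<Rightarrow> real"
  assumes cont: "continuous_on {r..T} W" and init: "0 \<le> W r"
    and mono: "\<And>s t. r \<le> s \<Longrightarrow> s \<le> t \<Longrightarrow> t \<le> T \<Longrightarrow> (\<And>u. u \<in> {s..t} \<Longrightarrow> W u \<le> 0) \<Longrightarrow> W s \<le> W t"
    and t: "t \<in> {r..T}"
  shows "0 \<le> W t"
proof (rule ccontr)
  assume neg: "\<not> 0 \<le> W t"
  define S where "S = {u \<in> {r..t}. 0 \<le> W u}"
  have cont': "continuous_on {r..t} W" using cont t by (auto intro: continuous_on_subset)
  have "S = {r..t} \<inter> W -` {0..}" by (auto simp: S_def)
  then have "closed S" using continuous_closed_preimage[OF cont'] by simp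
  have "r \<in> S" using init t by (simp add: S_def)
  have bdd: "bdd_above S" by (rule bdd_aboveI[of _ t]) (simp add: S_def)
  define s where "s = Sup S"
  have "s \<in> S" unfolding s_def using \<open>closed S\<close> \<open>r \<in> S\<close> bdd closed_contains_Sup by blast
  then have s: "r \<le> s" "s \<le> t" "0 \<le> W s" by (auto simp: S_def)
  have after: "W u < 0" if "s < u" "u \<le> t" for u
  proof (rule ccontr)
    assume "\<not> W u < 0"
    then have "u \<in> S" using that s by (simp add: S_def)
    then have "u \<le> s" unfolding s_def by (rule cSup_upper[OF _ bdd])
    with that show False by simp
  qed
  have "W s \<le> 0"
  proof (rule ccontr)
    assume "\<not> W s \<le> 0"
    moreover have "continuous_on {s..t} W" using cont' s by (auto intro: continuous_on_subset)
    ultimately obtain u where u: "s \<le> u" "u \<le> t" "W u = 0"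
      using IVT2'[of W t 0 s] neg s by auto
    then show False using after[of u] \<open>\<not> W s \<le> 0\<close> by (cases "s = u") auto
  qed
  then have "W u \<le> 0" if "u \<in> {s..t}" for u
    using after[of u] that by (cases "u = s") auto
  then have "W s \<le> W t" using mono[of s t] s t by simp
  then show False using s neg by simp
qed

text \<open>A primitive frozen at \<open>a\<close> has one kink, which is a permitted exceptional
  point. It serves twice: for the ramps of the supersolution, and for the exponential weight over
  the span in which a delay can reach the initial function.\<close>

lemma has_integral_stopped:
  fixes P P' :: "real \<Rightarrow> real"
  assumes P: "\<And>u. (P has_real_derivative P' u) (at u)" and "s \<le> t"
  shows "((\<lambda>u. if u < a then P' u else 0) has_integral (P (min t a) - P (min s a))) {s..t}"
proof (rule fundamental_theorem_of_calculus_strong[of "{a}"])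
  have "continuous_on UNIV P" by (rule DERIV_continuous_on) (rule P)
  then show "continuous_on {s..t} (\<lambda>u. P (min u a))"
    by (rule continuous_on_compose2) (auto intro!: continuous_intros)
  fix u assume u: "u \<in> {s..t} - {a}"
  show "((\<lambda>u. P (min u a)) has_vector_derivative (if u < a then P' u else 0)) (at u)"
  proof (cases "u < a")
    case True
    have "(P has_vector_derivative P' u) (at u)"
      using P by (simp add: has_real_derivative_iff_has_vector_derivative)
    then have "((\<lambda>u. P (min u a)) has_vector_derivative P' u) (at u)"
      by (rule has_vector_derivative_transform_within_open[of _ _ _ "{..<a}"]) (use True in auto)
    then show ?thesis using True by simp
  next
    case False
    have "((\<lambda>u. P a) has_vector_derivative 0) (at u)" by (rule has_vector_derivative_const)
    then have "((\<lambda>u. P (min u a)) has_vector_derivative 0) (at u)"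
      by (rule has_vector_derivative_transform_within_open[of _ _ _ "{a<..}"]) (use False u in auto)
    then show ?thesis using False by simp
  qed
qed (use assms in auto)

lemma integral_atLeastAtMost_diff:
  fixes g :: "real \<Rightarrow> real"
  assumes "g integrable_on {r..T}" "r \<le> s" "s \<le> t" "t \<le> T"
  shows "integral {r..t} g - integral {r..s} g = integral {s..t} g"
proof -
  have "g integrable_on {r..t}"
    by (rule integrable_subinterval_real[OF assms(1)]) (use assms in auto)
  from Henstock_Kurzweil_Integration.integral_combine[OF assms(2,3) this] show ?thesis by simp
qed

lemma abs_integral_diff_le:
  fixes G g :: "real \<Rightarrow> real"
  assumes G: "G integrable_on {r..T}" and g: "g integrable_on {r..T}"
    and le: "\<And>s. s \<in> {r..T} \<Longrightarrow> \<bar>G s\<bar> \<le> g s"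
    and st: "r \<le> s" "s \<le> t" "t \<le> T"
  shows "\<bar>integral {r..t} G - integral {r..s} G\<bar> \<le> integral {r..t} g - integral {r..s} g"
proof -
  have sub: "{s..t} \<subseteq> {r..T}" using st by auto
  have "norm (integral {s..t} G) \<le> integral {s..t} g"
    by (rule Henstock_Kurzweil_Integration.integral_norm_bound_integral)
      (use integrable_subinterval_real[OF G sub] integrable_subinterval_real[OF g sub] le sub in auto)
  then show ?thesis
    by (simp add: integral_atLeastAtMost_diff[OF G st] integral_atLeastAtMost_diff[OF g st])
qed

section \<open>The uniform bound for fundamental solutions\<close>

context delay_system
begin

text \<open>The coefficient \<open>a\<close> of the original problem: the decay rate that remains
  after the exponential weight has taken \<open>lam\<close> away.\<close>

definition net :: "real \<Rightarrow> real" where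
  "net s = (\<Sum>k\<in>I. c k s) - lam"

lemma net_bounds: "0 < net s" "net s \<le> L"
proof -
  show "0 < net s" using dominated[of s] by (simp add: net_def)
  have "(\<Sum>k\<in>I. c k s) \<le> (\<Sum>k\<in>I. B k)"
    by (intro sum_mono) (use c_bound in \<open>force simp: abs_le_iff\<close>)
  then show "net s \<le> L" using lam by (simp add: net_def L_def)
qed

lemma rhs_net: "rhs z s + net s * z s = (\<Sum>k\<in>I. c k s * (z s - z (h k s)))"
  by (simp add: rhs_def net_def algebra_simps sum_subtractf sum_distrib_left)

lemma M1_nonneg: "0 \<le> M1"
  unfolding M1_def using L_pos tau_nonneg p_nonneg by (intro mult_nonneg_nonneg sum_nonneg) auto

text \<open>Here \<open>K\<close> is an arbitrary bound, to be improved afterwards. \<open>V\<close>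
  and \<open>Y\<close> both equal 1 at \<open>r\<close>, and \<open>V - Y\<close> and
  \<open>V + Y\<close> are compared with zero by the sign of their increments.\<close>

lemma fundamental_supersolution:
  assumes Y: "fundamental r Y" and K: "\<And>u. u \<le> T \<Longrightarrow> \<bar>Y u\<bar> \<le> K" and t: "t \<in> {r..T}"
  shows "\<bar>Y t\<bar> \<le> 1 + (\<Sum>k\<in>I. p k * K * L * min (t - r) (\<tau> k))"
proof -
  have K0: "0 \<le> K" using K[of t] t by auto
  have Ycont: "continuous_on {r..T} Y"
    using Y by (auto simp: fundamental_def intro: continuous_on_subset)
  have Y0: "Y u = 0" if "u < r" for u using Y that by (simp add: fundamental_def)
  have Yeq: "Y t = 1 + integral {r..t} (rhs Y)" if "r \<le> t" for t
    using Y that by (simp add: fundamental_def)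
  have int: "rhs Y integrable_on {r..T}"
    by (rule rhs_integrable[OF fundamental_measurable[OF Y] K])
  have Ydiff: "Y t - Y s = integral {s..t} (rhs Y)" if "r \<le> s" "s \<le> t" "t \<le> T" for s t
    using integral_atLeastAtMost_diff[OF int that] that by (simp add: Yeq)
  have lip: "\<bar>Y t - Y s\<bar> \<le> L * K * (t - s)" if "r \<le> s" "s \<le> t" "t \<le> T" for s t
  proof -
    have "\<bar>rhs Y u\<bar> \<le> L * K" if "u \<in> {r..T}" for u
      using that by (intro rhs_bound K) auto
    from abs_integral_diff_le[OF int integrable_const_ivl this that]
    show ?thesis using that by (simp add: Yeq algebra_simps)
  qed
  define V where "V = (\<lambda>t. 1 + (\<Sum>k\<in>I. p k * K * L * min (t - r) (\<tau> k)))"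
  define V' where "V' = (\<lambda>t. \<Sum>k\<in>I. p k * K * L * (if t < r + \<tau> k then 1 else 0))"
  have Vint: "(V' has_integral (V t - V s)) {s..t}" if "s \<le> t" for s t
  proof -
    have "min (t - r) (\<tau> k) - min (s - r) (\<tau> k) = min t (r + \<tau> k) - min s (r + \<tau> k)" for k
      by (auto simp: min_def)
    then have "V t - V s = (\<Sum>k\<in>I. p k * K * L * (min t (r + \<tau> k) - min s (r + \<tau> k)))"
      by (simp add: V_def flip: sum_subtractf right_diff_distrib)
    then show ?thesis unfolding V'_def
      using that by (auto intro!: has_integral_sum finite_I has_integral_mult_right
          has_integral_stopped[of "\<lambda>u. u" "\<lambda>_. 1"])
  qed
  have step: "\<bar>rhs Y u + net u * Y u\<bar> \<le> V' u + net u * V u" if u: "u \<in> {r..T}" for u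
  proof -
    have each: "\<bar>c k u * (Y u - Y (h k u))\<bar>
        \<le> p k * K * L * (if u < r + \<tau> k then 1 else 0) + net u * (p k * K * L * min (u - r) (\<tau> k))"
      (is "_ \<le> ?A + ?B") if k: "k \<in> I" for k
    proof -
      have c: "\<bar>c k u\<bar> \<le> p k * net u" using ratio[OF k] by (simp add: net_def)
      have A0: "0 \<le> ?A" using p_nonneg[OF k] K0 L_pos by simp
      have B0: "0 \<le> ?B" using p_nonneg[OF k] K0 L_pos u net_bounds(1)[of u] tau_nonneg[OF k] by simp
      have h: "u - \<tau> k \<le> h k u" "h k u \<le> u" using delay[OF k, of u] by auto
      show ?thesis
      proof (cases "h k u < r")
        case True
        then have "\<bar>c k u * (Y u - Y (h k u))\<bar> = \<bar>c k u\<bar> * \<bar>Y u\<bar>" by (simp add: Y0 abs_mult)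
        also have "\<dots> \<le> (p k * L) * K"
        proof (intro mult_mono K)
          have "p k * net u \<le> p k * L" by (intro mult_left_mono net_bounds p_nonneg[OF k])
          with c show "\<bar>c k u\<bar> \<le> p k * L" by simp
        qed (use u L_pos p_nonneg[OF k] in auto)
        also have "\<dots> = ?A" using True h by simp
        finally show ?thesis using B0 by simp
      next
        case False
        have "\<bar>c k u * (Y u - Y (h k u))\<bar> = \<bar>c k u\<bar> * \<bar>Y u - Y (h k u)\<bar>" by (simp add: abs_mult)
        also have "\<dots> \<le> (p k * net u) * (L * K * min (u - r) (\<tau> k))"
        proof (intro mult_mono c)
          have "\<bar>Y u - Y (h k u)\<bar> \<le> L * K * (u - h k u)" using lip[of "h k u" u] False h u by simp
          also have "\<dots> \<le> L * K * min (u - r) (\<tau> k)"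
            using False h L_pos K0 by (intro mult_left_mono) auto
          finally show "\<bar>Y u - Y (h k u)\<bar> \<le> L * K * min (u - r) (\<tau> k)" .
        qed (use net_bounds(1)[of u] p_nonneg[OF k] in auto)
        also have "\<dots> = ?B" by (simp add: algebra_simps)
        finally show ?thesis using A0 by simp
      qed
    qed
    have "\<bar>rhs Y u + net u * Y u\<bar> \<le> (\<Sum>k\<in>I. \<bar>c k u * (Y u - Y (h k u))\<bar>)"
      unfolding rhs_net by (rule sum_abs)
    also have "\<dots> \<le> V' u + net u * (\<Sum>k\<in>I. p k * K * L * min (u - r) (\<tau> k))"
      unfolding V'_def sum_distrib_left[of "net u"] sum.distrib[symmetric] by (rule sum_mono) (rule each)
    also have "\<dots> \<le> V' u + net u * V u"
      using net_bounds(1)[of u] by (intro add_left_mono mult_left_mono) (auto simp: V_def)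
    finally show ?thesis .
  qed
  \<comment> \<open>The sign \<open>\<sigma>\<close> treats both halves of the absolute value at
    once.\<close>
  have "0 \<le> V t - \<sigma> * Y t" if \<sigma>: "\<bar>\<sigma>\<bar> = 1" for \<sigma>
  proof (rule nonneg_by_comparison[OF _ _ _ t, of "\<lambda>t. V t - \<sigma> * Y t"])
    show "continuous_on {r..T} (\<lambda>t. V t - \<sigma> * Y t)"
      unfolding V_def by (intro continuous_intros Ycont)
    have "V r = 1" "Y r = 1" using Yeq[of r] tau_nonneg by (auto simp: V_def)
    then show "0 \<le> V r - \<sigma> * Y r" using \<sigma> by (simp add: abs_le_iff)
    fix s t assume st: "r \<le> s" "s \<le> t" "t \<le> T" and neg: "\<And>u. u \<in> {s..t} \<Longrightarrow> V u - \<sigma> * Y u \<le> 0"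
    have "rhs Y integrable_on {s..t}" by (rule integrable_subinterval_real[OF int]) (use st in auto)
    then have "((\<lambda>u. V' u - \<sigma> * rhs Y u) has_integral (V t - V s - \<sigma> * (Y t - Y s))) {s..t}"
      unfolding Ydiff[OF st]
      by (intro has_integral_diff Vint st has_integral_mult_right integrable_integral)
    moreover have "0 \<le> V' u - \<sigma> * rhs Y u" if u: "u \<in> {s..t}" for u
    proof -
      have "\<sigma> * (rhs Y u + net u * Y u) \<le> \<bar>rhs Y u + net u * Y u\<bar>"
        using \<sigma> by (metis abs_ge_self abs_mult mult_1)
      also have "\<dots> \<le> V' u + net u * V u" using step[of u] u st by simp
      \<comment> \<open>Where \<open>V - \<sigma> * Y\<close> is nonpositive, the damping term
        \<open>net\<close> pushes it back up, so its increments are nonnegative.\<close>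
      finally have "V' u - \<sigma> * rhs Y u \<ge> - (net u * (V u - \<sigma> * Y u))" by (simp add: algebra_simps)
      moreover have "net u * (V u - \<sigma> * Y u) \<le> 0"
        using net_bounds(1)[of u] neg[OF u] by (simp add: mult_le_0_iff)
      ultimately show ?thesis by linarith
    qed
    ultimately have "0 \<le> V t - V s - \<sigma> * (Y t - Y s)"
      using has_integral_nonneg by blast
    then show "V s - \<sigma> * Y s \<le> V t - \<sigma> * Y t" by (simp add: algebra_simps)
  qed
  from this[of 1] this[of "-1"] show ?thesis unfolding V_def by (simp add: abs_le_iff)
qed

text \<open>Absorbing \<open>M1 * K\<close> requires a finite supremum, hence the compact interval
  \<open>{r..t}\<close>; the resulting bound depends on neither endpoint.\<close>

lemma fundamental_bound:
  assumes Y: "fundamental r Y" and M1: "M1 < 1"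
  shows "\<bar>Y t\<bar> \<le> 1 / (1 - M1)"
proof (cases "t < r")
  case True
  then show ?thesis using Y M1 by (simp add: fundamental_def)
next
  case False
  define K where "K = (SUP u\<in>{r..t}. \<bar>Y u\<bar>)"
  obtain X where X: "\<And>u. u \<le> t \<Longrightarrow> \<bar>Y u\<bar> \<le> X" by (rule fundamental_bounded[OF Y, of t]) blast
  have YK: "\<bar>Y u\<bar> \<le> K" if "u \<in> {r..t}" for u
    unfolding K_def using that X by (intro cSUP_upper bdd_aboveI2[of _ _ X]) auto
  have "0 \<le> K" using YK[of r] False by (simp add: order_trans[OF abs_ge_zero])
  have YK': "\<bar>Y u\<bar> \<le> K" if "u \<le> t" for u
    using YK[of u] that Y \<open>0 \<le> K\<close> by (cases "u < r") (auto simp: fundamental_def)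
  have "\<bar>Y u\<bar> \<le> 1 + M1 * K" if "u \<in> {r..t}" for u
  proof -
    have "\<bar>Y u\<bar> \<le> 1 + (\<Sum>k\<in>I. p k * K * L * min (u - r) (\<tau> k))"
      by (rule fundamental_supersolution[OF Y YK' that])
    also have "\<dots> \<le> 1 + (\<Sum>k\<in>I. p k * K * L * \<tau> k)"
      using p_nonneg \<open>0 \<le> K\<close> L_pos by (intro add_left_mono sum_mono mult_left_mono) auto
    also have "\<dots> = 1 + M1 * K"
      by (simp add: M1_def sum_distrib_left sum_distrib_right algebra_simps)
    finally show ?thesis .
  qed
  then have "K \<le> 1 + M1 * K"
    using False by (subst (1) K_def, intro cSUP_least) auto
  then have "K \<le> 1 / (1 - M1)" using M1 by (simp add: field_simps)
  then show ?thesis using YK[of t] False by simp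
qed

section \<open>Forced solutions by superposition of fundamental solutions\<close>

text \<open>Approximating the forcing by jumps turns it into a finite superposition of fundamental
  solutions. Estimating the forced solution directly only gives the factor \<open>(1 + M1) / (1 - M1)\<close>.\<close>

lemma forced_bound_approx:
  assumes M1: "M1 < 1" and z: "z \<in> borel_measurable borel"
    and zero: "\<And>t. t < r \<Longrightarrow> z t = 0" and bdd: "\<And>t. t \<le> T \<Longrightarrow> \<bar>z t\<bar> \<le> K"
    and eq: "\<And>t. r \<le> t \<Longrightarrow> t \<le> T \<Longrightarrow> z t = z0 + integral {r..t} (rhs z) + integral {r..t} G"
    and G: "G integrable_on {r..T}" and g: "g integrable_on {r..T}"
    and le: "\<And>s. s \<in> {r..T} \<Longrightarrow> \<bar>G s\<bar> \<le> g s" and C: "\<And>s. s \<in> {r..T} \<Longrightarrow> \<bar>G s\<bar> \<le> C"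
    and rT: "r < T" and n: "0 < (n::nat)"
  shows "\<bar>z T\<bar> \<le> 1 / (1 - M1) * (\<bar>z0\<bar> + integral {r..T} g)
    + 2 * C * (T - r) * exp (2 * L * (T - r)) / n"
proof -
  define d where "d = (T - r) / n"
  define \<rho> where "\<rho> i = r + real i * d" for i
  have d: "d > 0" using rT n by (simp add: d_def)
  have nd: "real n * d = T - r" using n by (simp add: d_def)
  have \<rho>T: "\<rho> n = T" "\<rho> 0 = r" by (auto simp: \<rho>_def nd)
  have \<rho>mono: "i \<le> j \<Longrightarrow> \<rho> i \<le> \<rho> j" for i j using d by (simp add: \<rho>_def)
  have \<rho>r: "r \<le> \<rho> i" for i using \<rho>mono[of 0 i] \<rho>T by simp
  have \<rho>le: "i \<le> n \<Longrightarrow> \<rho> i \<le> T" for i using \<rho>mono[of i n] \<rho>T by simp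
  have "\<forall>i. \<exists>y. fundamental (\<rho> i) y" using fundamental_exists by simp
  then obtain Y where Y: "fundamental (\<rho> i) (Y i)" for i by (rule choice[THEN exE]) blast
  have Ym: "Y i \<in> borel_measurable borel" for i by (rule fundamental_measurable[OF Y])
  have YM: "\<bar>Y i t\<bar> \<le> 1 / (1 - M1)" for i t by (rule fundamental_bound[OF Y M1])
  have Yint: "rhs (Y i) integrable_on {r..t}" for i t
    by (rule rhs_integrable[OF Ym YM])
  \<comment> \<open>All fundamental solutions are rewritten with the common lower limit
    \<open>r\<close>, so that they can be added; the jump time survives as an indicator.\<close>
  have Yeq: "Y i t = (if \<rho> i \<le> t then 1 else 0) + integral {r..t} (rhs (Y i))" for i t
  proof -
    have 0: "rhs (Y i) s = 0" if "s < \<rho> i" for s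
      using rhs_bound[of s "Y i" 0] Y[of i] that by (simp add: fundamental_def)
    show ?thesis
    proof (cases "\<rho> i \<le> t")
      case True
      have "integral {r..\<rho> i} (rhs (Y i)) = integral {r..\<rho> i} (\<lambda>_. 0)"
        by (rule integral_spike[of "{\<rho> i}"]) (use 0 in auto)
      then have "integral {r..t} (rhs (Y i)) = integral {\<rho> i..t} (rhs (Y i))"
        using integral_atLeastAtMost_diff[OF Yint \<rho>r True order_refl, of i] by simp
      then show ?thesis using True Y[of i] by (simp add: fundamental_def)
    next
      case False
      then have "integral {r..t} (rhs (Y i)) = integral {r..t} (\<lambda>_. 0)"
        by (intro integral_cong) (use 0 in auto)
      then show ?thesis using False Y[of i] by (simp add: fundamental_def)
    qed
  qed
  define J where "J t = integral {r..t} G" for t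
  define c where "c i = J (\<rho> (Suc i)) - J (\<rho> i)" for i
  \<comment> \<open>The mass of the forcing on each cell, \<open>c i\<close>, is released as one
    jump at the left endpoint of the cell.\<close>
  define S where "S t = z0 * Y 0 t + (\<Sum>i<n. c i * Y i t)" for t
  define D where "D t = z t - S t" for t
  have Sm: "S \<in> borel_measurable borel"
    unfolding S_def[abs_def] using Ym by measurable
  have Dm: "D \<in> borel_measurable borel"
    unfolding D_def[abs_def] using z Sm by measurable
  have S_bound: "\<bar>S t\<bar> \<le> 1 / (1 - M1) * (\<bar>z0\<bar> + (\<Sum>i<n. \<bar>c i\<bar>))" for t
  proof -
    have "\<bar>S t\<bar> \<le> \<bar>z0 * Y 0 t\<bar> + (\<Sum>i<n. \<bar>c i * Y i t\<bar>)"
      unfolding S_def by (rule order_trans[OF abs_triangle_ineq add_left_mono[OF sum_abs]])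
    also have "\<dots> \<le> \<bar>z0\<bar> * (1 / (1 - M1)) + (\<Sum>i<n. \<bar>c i\<bar> * (1 / (1 - M1)))"
      unfolding abs_mult by (intro add_mono sum_mono mult_left_mono YM) auto
    finally show ?thesis by (simp add: algebra_simps sum_distrib_left add_divide_distrib sum_divide_distrib)
  qed
  have rhsD: "rhs D = (\<lambda>s. rhs z s - (z0 * rhs (Y 0) s + (\<Sum>i<n. c i * rhs (Y i) s)))"
  proof
    fix s
    have "rhs S s = z0 * rhs (Y 0) s + (\<Sum>i<n. c i * rhs (Y i) s)"
    proof -
      have "rhs (\<lambda>t. z0 * Y 0 t - (-1) * (\<Sum>i<n. c i * Y i t)) s
          = z0 * rhs (Y 0) s - (-1) * (\<Sum>i<n. c i * rhs (Y i) s)"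
        by (simp only: rhs_diff rhs_scale rhs_sum)
      then show ?thesis by (simp add: S_def[abs_def])
    qed
    then show "rhs D s = rhs z s - (z0 * rhs (Y 0) s + (\<Sum>i<n. c i * rhs (Y i) s))"
      unfolding D_def[abs_def] rhs_diff by simp
  qed
  have zint: "rhs z integrable_on {r..t}" if "t \<le> T" for t
    by (rule rhs_integrable[OF z, of t K]) (use bdd that in auto)
  have intD: "integral {r..t} (rhs D) = integral {r..t} (rhs z)
      - (z0 * integral {r..t} (rhs (Y 0)) + (\<Sum>i<n. c i * integral {r..t} (rhs (Y i))))" if "t \<le> T" for t
  proof (rule integral_unique)
    show "(rhs D has_integral integral {r..t} (rhs z)
      - (z0 * integral {r..t} (rhs (Y 0)) + (\<Sum>i<n. c i * integral {r..t} (rhs (Y i))))) {r..t}"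
      unfolding rhsD
      by (intro has_integral_diff has_integral_add has_integral_sum has_integral_mult_right
          integrable_integral zint that Yint) auto
  qed
  \<comment> \<open>The step function has already received the whole mass of the current cell: the
    sum telescopes to \<open>J\<close> at the right endpoint, which is at most \<open>d\<close>
    ahead of \<open>t\<close>.\<close>
  have err: "\<bar>J t - (\<Sum>i<n. if \<rho> i \<le> t then c i else 0)\<bar> \<le> C * d" if t: "r \<le> t" "t \<le> T" for t
  proof -
    \<comment> \<open>\<open>j\<close> is the last cell that starts no later than \<open>t\<close>;
      for \<open>t = T\<close> it is \<open>n - 1\<close>, since there is no jump at
      \<open>\<rho> n\<close>.\<close>
    obtain j where j: "j < n" "\<rho> j \<le> t" "t \<le> \<rho> (Suc j)" and iff: "\<And>i. i < n \<Longrightarrow> \<rho> i \<le> t \<longleftrightarrow> i \<le> j"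
    proof -
      define A where "A = {i. i < n \<and> \<rho> i \<le> t}"
      have A: "finite A" "0 \<in> A" using n t \<rho>T by (auto simp: A_def)
      then have "Max A \<in> A" by (metis Max_in empty_iff)
      have "t \<le> \<rho> (Suc (Max A))"
      proof (cases "Suc (Max A) < n")
        case True
        have "Suc (Max A) \<notin> A" using A Max_ge by (metis not_less_eq_eq order_refl)
        then show ?thesis using True by (simp add: A_def)
      next
        case False
        then have "Suc (Max A) = n" using \<open>Max A \<in> A\<close> by (simp add: A_def)
        then show ?thesis using \<rho>T t by simp
      qed
      moreover have "\<rho> i \<le> t \<longleftrightarrow> i \<le> Max A" if "i < n" for i
        using that A \<open>Max A \<in> A\<close> \<rho>mono[of i "Max A"] by (auto simp: A_def)
      moreover have "Max A < n" "\<rho> (Max A) \<le> t" using \<open>Max A \<in> A\<close> by (simp_all only: A_def mem_Collect_eq)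
      ultimately show thesis by (intro that)
    qed
    have "(\<Sum>i<n. if \<rho> i \<le> t then c i else 0) = (\<Sum>i\<in>{i. i < n \<and> \<rho> i \<le> t}. c i)"
      by (simp add: sum.If_cases lessThan_def Int_def)
    also have "{i. i < n \<and> \<rho> i \<le> t} = {..<Suc j}" using iff j(1) by auto
    also have "(\<Sum>i<Suc j. c i) = J (\<rho> (Suc j))"
      unfolding c_def using sum_lessThan_telescope[of "\<lambda>i. J (\<rho> i)" "Suc j"]
      by (simp only: \<rho>T) (simp add: J_def)
    finally have "(\<Sum>i<n. if \<rho> i \<le> t then c i else 0) = J (\<rho> (Suc j))" .
    moreover have "\<bar>J (\<rho> (Suc j)) - J t\<bar> \<le> C * (\<rho> (Suc j) - t)"
      unfolding J_def
      using abs_integral_diff_le[OF G integrable_const_ivl C t(1) j(3) \<rho>le] j t \<rho>r by (simp add: algebra_simps)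
    moreover have "C * (\<rho> (Suc j) - t) \<le> C * d"
    proof (rule mult_left_mono)
      show "\<rho> (Suc j) - t \<le> d" using j(2) by (simp add: \<rho>_def algebra_simps)
      show "0 \<le> C" using C[of r] rT by (simp add: order_trans[OF abs_ge_zero])
    qed
    ultimately show ?thesis by (simp add: abs_minus_commute)
  qed
  \<comment> \<open>\<open>D\<close> solves the homogeneous equation up to the defect
    \<open>C * d\<close>, so \<open>stability\<close> makes it of the order of the mesh
    size.\<close>
  have "\<bar>D T\<bar> \<le> 2 * (C * d) * exp (2 * L * (T - r))"
  proof (rule stability[OF Dm])
    show "D t = 0" if "t < r" for t
    proof -
      have "Y i t = 0" for i using Y[of i] that \<rho>r[of i] by (simp add: fundamental_def)
      then show ?thesis using zero[OF that] by (simp add: D_def S_def)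
    qed
    show "\<bar>D t\<bar> \<le> K + 1 / (1 - M1) * (\<bar>z0\<bar> + (\<Sum>i<n. \<bar>c i\<bar>))" if "t \<le> T" for t
      unfolding D_def using bdd[OF that] S_bound[of t] by linarith
    fix t assume t: "r \<le> t" "t \<le> T"
    have "(\<Sum>i<n. c i * Y i t) = (\<Sum>i<n. (if \<rho> i \<le> t then c i else 0) + c i * integral {r..t} (rhs (Y i)))"
      by (rule sum.cong) (auto simp: Yeq[of _ t] algebra_simps)
    moreover have "z0 * Y 0 t = z0 + z0 * integral {r..t} (rhs (Y 0))"
      using t \<rho>T by (subst Yeq) (simp add: algebra_simps)
    ultimately have "D t = integral {r..t} (rhs D) + (J t - (\<Sum>i<n. if \<rho> i \<le> t then c i else 0))"
      unfolding D_def S_def eq[OF t] intD[OF t(2)] J_def by (simp add: sum.distrib)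
    then show "\<bar>D t\<bar> \<le> C * d + \<bar>integral {r..t} (rhs D)\<bar>" using err[OF t] by linarith
  qed (use rT in auto)
  \<comment> \<open>The total size of the jumps is bounded by the integral of \<open>g\<close> on
    every grid, so the main term has its final form before the limit.\<close>
  moreover have "(\<Sum>i<n. \<bar>c i\<bar>) \<le> integral {r..T} g"
  proof -
    have "(\<Sum>i<n. \<bar>c i\<bar>) \<le> (\<Sum>i<n. integral {r..\<rho> (Suc i)} g - integral {r..\<rho> i} g)"
      unfolding c_def J_def
      by (intro sum_mono abs_integral_diff_le[OF G g le] \<rho>r \<rho>mono \<rho>le) auto
    also have "\<dots> = integral {r..T} g"
      using sum_lessThan_telescope[of "\<lambda>i. integral {r..\<rho> i} g" n] by (simp add: \<rho>T)
    finally show ?thesis .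
  qed
  then have "1 / (1 - M1) * (\<bar>z0\<bar> + (\<Sum>i<n. \<bar>c i\<bar>)) \<le> 1 / (1 - M1) * (\<bar>z0\<bar> + integral {r..T} g)"
    using M1 by (intro mult_left_mono) auto
  moreover have "2 * (C * d) * exp (2 * L * (T - r)) = 2 * C * (T - r) * exp (2 * L * (T - r)) / n"
    by (simp add: d_def)
  ultimately show ?thesis using S_bound[of T] unfolding D_def by linarith
qed

text \<open>The mesh error is a fixed number divided by the number of jumps and vanishes in the
  limit. A grid needs \<open>r < T\<close>; on the degenerate interval
  \<open>1 \<le> 1 / (1 - M1)\<close> suffices.\<close>

lemma forced_bound:
  assumes M1: "M1 < 1" and z: "z \<in> borel_measurable borel"
    and zero: "\<And>t. t < r \<Longrightarrow> z t = 0" and bdd: "\<And>t. t \<le> T \<Longrightarrow> \<bar>z t\<bar> \<le> K"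
    and eq: "\<And>t. r \<le> t \<Longrightarrow> t \<le> T \<Longrightarrow> z t = z0 + integral {r..t} (rhs z) + integral {r..t} G"
    and G: "G integrable_on {r..T}" and g: "g integrable_on {r..T}"
    and le: "\<And>s. s \<in> {r..T} \<Longrightarrow> \<bar>G s\<bar> \<le> g s" and C: "\<And>s. s \<in> {r..T} \<Longrightarrow> \<bar>G s\<bar> \<le> C"
    and rT: "r \<le> T"
  shows "\<bar>z T\<bar> \<le> 1 / (1 - M1) * (\<bar>z0\<bar> + integral {r..T} g)"
proof (cases "r = T")
  case True
  have "1 \<le> 1 / (1 - M1)" using M1 M1_nonneg by simp
  then have "1 * \<bar>z0\<bar> \<le> 1 / (1 - M1) * \<bar>z0\<bar>" by (intro mult_right_mono) auto
  then show ?thesis using eq[of T] True by simp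
next
  case False
  define Q where "Q = 2 * C * (T - r) * exp (2 * L * (T - r))"
  define R where "R = 1 / (1 - M1) * (\<bar>z0\<bar> + integral {r..T} g)"
  have "\<bar>z T\<bar> \<le> R + Q * inverse (real (Suc n))" for n
    using forced_bound_approx[OF M1 z zero bdd eq G g le C, of "Suc n"] False rT
    unfolding Q_def R_def by (simp add: divide_inverse)
  moreover have "(\<lambda>n. R + Q * inverse (real (Suc n))) \<longlonglongrightarrow> R + Q * 0"
    by (intro tendsto_intros LIMSEQ_inverse_real_of_nat)
  ultimately have "\<bar>z T\<bar> \<le> R + Q * 0" by (intro LIMSEQ_le_const) auto
  then show ?thesis by (simp add: R_def)
qed

end

section \<open>Essential suprema and the exponential estimate\<close>

lemma ess_norm_nonneg:
  assumes "ess_bounded_on J g"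
  shows "0 \<le> ess_norm J g"
proof -
  obtain X where X: "AE t in lebesgue. t \<in> J \<longrightarrow> \<bar>g t\<bar> \<le> X"
    using assms by (auto simp: ess_bounded_on_def)
  have "AE t in lebesgue. t \<in> J \<longrightarrow> \<bar>g t\<bar> \<le> max X 0" using X by eventually_elim auto
  then show ?thesis unfolding ess_norm_def by (intro cInf_greatest) (auto intro!: exI[of _ "max X 0"])
qed

text \<open>The infimum is itself an essential bound: each
  \<open>Inf S + inverse (real (Suc n))\<close> is one, and countably many exceptional null sets may
  be united. Boundedness makes \<open>S\<close> nonempty, so that its infimum is meaningful.\<close>

lemma AE_le_ess_norm:
  assumes "ess_bounded_on J g"
  shows "AE t in lebesgue. t \<in> J \<longrightarrow> \<bar>g t\<bar> \<le> ess_norm J g"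
proof -
  define S where "S = {B. 0 \<le> B \<and> (AE t in lebesgue. t \<in> J \<longrightarrow> \<bar>g t\<bar> \<le> B)}"
  obtain X where X: "AE t in lebesgue. t \<in> J \<longrightarrow> \<bar>g t\<bar> \<le> X"
    using assms by (auto simp: ess_bounded_on_def)
  have "AE t in lebesgue. t \<in> J \<longrightarrow> \<bar>g t\<bar> \<le> max X 0" using X by eventually_elim auto
  then have S: "S \<noteq> {}" by (auto simp: S_def intro!: exI[of _ "max X 0"])
  have "AE t in lebesgue. t \<in> J \<longrightarrow> \<bar>g t\<bar> \<le> Inf S + inverse (real (Suc n))" for n
  proof -
    have "Inf S < Inf S + inverse (real (Suc n))" by simp
    then obtain Z where Z: "Z \<in> S" "Z < Inf S + inverse (real (Suc n))"
      using cInf_lessD[OF S] by blast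
    then have "AE t in lebesgue. t \<in> J \<longrightarrow> \<bar>g t\<bar> \<le> Z" by (simp add: S_def)
    then show ?thesis by eventually_elim (use Z in auto)
  qed
  then have "AE t in lebesgue. \<forall>n. t \<in> J \<longrightarrow> \<bar>g t\<bar> \<le> Inf S + inverse (real (Suc n))"
    unfolding AE_all_countable by (rule allI)
  then show ?thesis
  proof eventually_elim
    case (elim t)
    have "(\<lambda>n. Inf S + inverse (real (Suc n))) \<longlonglongrightarrow> Inf S + 0"
      by (intro tendsto_intros LIMSEQ_inverse_real_of_nat)
    then have "\<bar>g t\<bar> \<le> Inf S + 0" if "t \<in> J"
      by (rule LIMSEQ_le_const) (use elim that in auto)
    then show ?case by (simp add: ess_norm_def S_def)
  qed
qed

lemma ess_bounded_on_subset: "ess_bounded_on J g \<Longrightarrow> J' \<subseteq> J \<Longrightarrow> ess_bounded_on J' g"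
  unfolding ess_bounded_on_def by (elim exE, rule exI, erule AE_mp) auto

text \<open>From \<open>1 - u \<le> exp (- u)\<close>. This is the Lipschitz bound that makes the
  weighted solution absolutely continuous.\<close>

lemma abs_exp_diff_le:
  fixes lam :: real
  assumes "0 < lam" "s \<le> t" "t \<le> T"
  shows "\<bar>exp (lam * (t - r)) - exp (lam * (s - r))\<bar> \<le> (exp (lam * (T - r)) * lam) * (t - s)"
proof -
  have "exp (lam * (s - r)) = exp (lam * (t - r)) * exp (- (lam * (t - s)))"
    by (simp add: algebra_simps flip: exp_add)
  then have "exp (lam * (t - r)) - exp (lam * (s - r)) = exp (lam * (t - r)) * (1 - exp (- (lam * (t - s))))"
    by (simp add: algebra_simps)
  also have "\<dots> \<le> exp (lam * (t - r)) * (lam * (t - s))"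
    using exp_ge_add_one_self[of "- (lam * (t - s))"] by (intro mult_left_mono) auto
  also have "\<dots> \<le> exp (lam * (T - r)) * (lam * (t - s))"
    using assms by (intro mult_right_mono) auto
  finally show ?thesis using assms by (simp add: mult.assoc)
qed

section \<open>Reduction of the original problem to the abstract delay system\<close>

theorem theorem4p1:
  fixes t0 :: real and m :: nat
    and b h :: "nat \<Rightarrow> real \<Rightarrow> real"
    and \<delta> \<tau>k :: "nat \<Rightarrow> real"
    and f \<phi> x :: "real \<Rightarrow> real"
    and lam \<alpha> :: real
  defines "\<tau> \<equiv> Max (\<tau>k ` {1..m})"
  defines "a \<equiv> (\<lambda>t. (\<Sum>k=1..m. exp (lam * (t - h k t)) * b k t) - lam)"
  defines "M1 \<equiv> (lam + (\<Sum>k=1..m. exp (lam * \<tau>k k) * ess_norm {t0..} (b k)))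
                 * (\<Sum>k=1..m. \<tau>k k * ess_norm {t0..} (\<lambda>t. exp (lam * (t - h k t)) * b k t / a t))"
  defines "M0 \<equiv> 1 / (1 - M1)"
  assumes t0: "0 \<le> t0" and m: "1 \<le> m"
    and b_meas: "\<And>k. k \<in> {1..m} \<Longrightarrow> set_borel_measurable lebesgue {0..} (b k)"
    and b_bdd: "\<And>k. k \<in> {1..m} \<Longrightarrow> ess_bounded_on {0..} (b k)"
    and h_meas: "\<And>k. k \<in> {1..m} \<Longrightarrow> set_borel_measurable lebesgue {0..} (h k)"
    and delays: "\<And>k. k \<in> {1..m} \<Longrightarrow> 0 \<le> \<delta> k \<and> \<delta> k \<le> \<tau>k k"
    and h_bounds: "\<And>k t. k \<in> {1..m} \<Longrightarrow> t \<ge> t0 \<Longrightarrow> \<delta> k \<le> t - h k t \<and> t - h k t \<le> \<tau>k k"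
    and f_meas: "set_borel_measurable lebesgue {t0..} f"
    and f_bdd: "\<And>T. T \<ge> t0 \<Longrightarrow> ess_bounded_on {t0..T} f"
    and phi_meas: "set_borel_measurable borel {t0 - \<tau>..t0} \<phi>"
    and phi_bdd: "bounded (\<phi> ` {t0 - \<tau>..t0})"
    and lam: "lam > 0" and alpha: "\<alpha> > 0"
    and a_ge: "\<And>t. t \<ge> t0 \<Longrightarrow> a t \<ge> \<alpha>"
    and M1_lt: "M1 < 1"
    and x_ac: "loc_abs_cont_from t0 x"
    and x_ode: "AE t in lebesgue. t \<ge> t0 \<longrightarrow>
                  (x has_real_derivative (f t - (\<Sum>k=1..m. b k t * x (h k t)))) (at t)"
    and x_init: "\<And>t. t \<in> {t0 - \<tau>..t0} \<Longrightarrow> x t = \<phi> t"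
  shows "\<forall>t\<ge>t0. \<bar>x t\<bar> \<le> M0 * exp (- lam * (t - t0)) *
            (\<bar>x t0\<bar> + (\<Sum>k=1..m. (exp (lam * \<tau>k k) - 1) / lam * ess_norm {t0..} (b k)
                            * sup_norm {t0 - \<tau>..t0} \<phi>))
          + M0 / lam * ess_norm {t0..t} f"
proof (intro allI impI)
  fix T :: real assume T: "t0 \<le> T"
  define I where "I = {1..m}"
  define \<beta> where "\<beta> k = ess_norm {t0..} (b k)" for k
  define ak where "ak k t = exp (lam * (t - h k t)) * b k t" for k t
  define p where "p k = ess_norm {t0..} (\<lambda>t. ak k t / a t)" for k
  define \<Phi> where "\<Phi> = sup_norm {t0 - \<tau>..t0} \<phi>"
  define F where "F = ess_norm {t0..T} f"
  have aI: "a t = (\<Sum>k\<in>I. ak k t) - lam" for t by (simp add: a_def ak_def I_def)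
  have finI: "finite I" by (simp add: I_def)
  have h_le: "t - \<tau>k k \<le> h k t" "h k t \<le> t" if "k \<in> I" "t0 \<le> t" for k t
    using h_bounds[of k t] delays[of k] that by (auto simp: I_def)
  have \<tau>: "\<tau>k k \<le> \<tau>" "0 \<le> \<tau>k k" if "k \<in> I" for k
    using that delays[of k] by (auto simp: \<tau>_def I_def)
  then have \<tau>0: "0 \<le> \<tau>" using m by (force simp: I_def)
  have b_ess: "ess_bounded_on {t0..} (b k)" if "k \<in> I" for k
    using ess_bounded_on_subset[OF b_bdd] t0 that by (auto simp: I_def)
  have \<beta>0: "0 \<le> \<beta> k" if "k \<in> I" for k
    unfolding \<beta>_def by (rule ess_norm_nonneg[OF b_ess[OF that]])
  have b_le: "AE t in lebesgue. t \<in> {t0..} \<longrightarrow> \<bar>b k t\<bar> \<le> \<beta> k" if "k \<in> I" for k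
    unfolding \<beta>_def by (rule AE_le_ess_norm[OF b_ess[OF that]])
  have ak_le: "\<bar>ak k t\<bar> \<le> exp (lam * \<tau>k k) * \<beta> k" if "k \<in> I" "t0 \<le> t" "\<bar>b k t\<bar> \<le> \<beta> k" for k t
    unfolding ak_def abs_mult using h_le[of k t] that lam by (intro mult_mono) auto
  \<comment> \<open>The lower bound \<open>\<alpha>\<close> on \<open>a\<close> makes the quotient
    essentially bounded, so that its essential norm really bounds it almost everywhere.\<close>
  have "ess_bounded_on {t0..} (\<lambda>t. ak k t / a t)" if k: "k \<in> I" for k
    unfolding ess_bounded_on_def
  proof (rule exI[of _ "exp (lam * \<tau>k k) * \<beta> k / \<alpha>"], use b_le[OF k] in eventually_elim, intro impI)
    fix t assume "t \<in> {t0..} \<longrightarrow> \<bar>b k t\<bar> \<le> \<beta> k" and t: "t \<in> {t0..}"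
    then have "\<bar>ak k t\<bar> \<le> exp (lam * \<tau>k k) * \<beta> k" using ak_le[OF k, of t] by simp
    then show "\<bar>ak k t / a t\<bar> \<le> exp (lam * \<tau>k k) * \<beta> k / \<alpha>"
      unfolding abs_divide using a_ge[of t] alpha t by (intro frac_le) auto
  qed
  note p_le = AE_le_ess_norm[OF this, folded p_def]
  have F0: "0 \<le> F" unfolding F_def by (rule ess_norm_nonneg[OF f_bdd[OF T]])
  have f_le: "AE t in lebesgue. t \<in> {t0..T} \<longrightarrow> \<bar>f t\<bar> \<le> F"
    unfolding F_def by (rule AE_le_ess_norm[OF f_bdd[OF T]])
  have "AE t in lebesgue. \<forall>k\<in>I. t \<in> {t0..} \<longrightarrow> \<bar>b k t\<bar> \<le> \<beta> k"
    unfolding AE_finite_all[OF finI] by (intro ballI b_le)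
  moreover have "AE t in lebesgue. \<forall>k\<in>I. t \<in> {t0..} \<longrightarrow> \<bar>ak k t / a t\<bar> \<le> p k"
    unfolding AE_finite_all[OF finI] by (intro ballI p_le)
  ultimately have "AE t in lebesgue. (\<forall>k\<in>I. t \<in> {t0..} \<longrightarrow> \<bar>b k t\<bar> \<le> \<beta> k)
      \<and> (\<forall>k\<in>I. t \<in> {t0..} \<longrightarrow> \<bar>ak k t / a t\<bar> \<le> p k) \<and> (t \<in> {t0..T} \<longrightarrow> \<bar>f t\<bar> \<le> F)
      \<and> (t \<ge> t0 \<longrightarrow> (x has_real_derivative (f t - (\<Sum>k=1..m. b k t * x (h k t)))) (at t))"
    using f_le x_ode by (intro AE_conjI)
  \<comment> \<open>One null set for all coefficients, the forcing and the differential equation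
    together.\<close>
  then obtain N where N: "N \<in> null_sets lebesgue"
    and good: "\<And>t. t \<notin> N \<Longrightarrow> (\<forall>k\<in>I. t \<in> {t0..} \<longrightarrow> \<bar>b k t\<bar> \<le> \<beta> k)
      \<and> (\<forall>k\<in>I. t \<in> {t0..} \<longrightarrow> \<bar>ak k t / a t\<bar> \<le> p k) \<and> (t \<in> {t0..T} \<longrightarrow> \<bar>f t\<bar> \<le> F)
      \<and> (t \<ge> t0 \<longrightarrow> (x has_real_derivative (f t - (\<Sum>k=1..m. b k t * x (h k t)))) (at t))"
    by (rule AE_E3) auto
  have negN: "negligible N" using N by (simp add: negligible_iff_null_sets)
  define S where "S = {t0..} - N"
  have Sm: "S \<in> sets lebesgue" unfolding S_def using N by auto
  have S_t0: "t0 \<le> t" if "t \<in> S" for t using that by (simp add: S_def)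
  obtain s0 where s0: "s0 \<in> S"
  proof -
    have "\<not> {t0..t0+1} \<subseteq> N"
      using negligible_subset[OF negN] negligible_interval(1)[of t0 "t0 + 1"] by auto
    then show thesis using that by (force simp: S_def)
  qed
  \<comment> \<open>The essential bounds become pointwise ones by giving the coefficients, on the exceptional null
    set and before \<open>t0\<close>, their values at one good point \<open>s0\<close>.\<close>
  define \<gamma> where "\<gamma> t = (if t \<in> S then t else s0)" for t
  have \<gamma>S: "\<gamma> t \<in> S" for t using s0 by (simp add: \<gamma>_def)
  define c where "c k t = ak k (\<gamma> t)" for k t
  \<comment> \<open>Before \<open>t0\<close> the delay is set to zero, which respects the required
    bounds because \<open>0 \<le> \<tau>k k\<close>.\<close>
  define h' where "h' k t = (if t0 \<le> t then h k t else t)" for k t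
  have id_meas: "(\<lambda>t::real. t) \<in> borel_measurable lebesgue"
    by (rule measurable_completion) simp
  interpret D: delay_system I c h' "\<lambda>k. exp (lam * \<tau>k k) * \<beta> k" \<tau>k p lam
  proof
    fix k assume k: "k \<in> I"
    \<comment> \<open>\<open>set_borel_measurable\<close> speaks of the product with the indicator;
      on \<open>S\<close>, which lies in \<open>{0..}\<close>, the cut changes nothing.\<close>
    define hI where "hI t = indicator {0..} t * h k t" for t
    define bI where "bI t = indicator {0..} t * b k t" for t
    have hI: "hI \<in> borel_measurable lebesgue" and bI: "bI \<in> borel_measurable lebesgue"
      using h_meas[of k] b_meas[of k] k
      by (simp_all add: set_borel_measurable_def hI_def[abs_def] bI_def[abs_def] I_def)
    have "c k = (\<lambda>t. if t \<in> S then exp (lam * (t - hI t)) * bI t else ak k s0)"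
      using t0 S_t0 by (force simp: c_def \<gamma>_def ak_def hI_def bI_def)
    also have "\<dots> \<in> borel_measurable lebesgue"
      using hI bI id_meas Sm by (intro measurable_If_set) (auto intro!: borel_measurable_times borel_measurable_diff borel_measurable_const measurable_compose[OF _ borel_measurable_exp])
    finally show "c k \<in> borel_measurable lebesgue" .
    have "h' k = (\<lambda>t. if t \<in> {t0..} then hI t else t)"
      using t0 by (auto simp: h'_def hI_def)
    also have "\<dots> \<in> borel_measurable lebesgue"
      using hI id_meas by (intro measurable_If_set) auto
    finally show "h' k \<in> borel_measurable lebesgue" .
    fix s
    show "\<bar>c k s\<bar> \<le> exp (lam * \<tau>k k) * \<beta> k"
      unfolding c_def using \<gamma>S[of s] good[of "\<gamma> s"] k by (intro ak_le) (auto simp: S_def)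
    show "s - \<tau>k k \<le> h' k s \<and> h' k s \<le> s"
      using h_le[OF k] \<tau>[OF k] by (auto simp: h'_def)
    have "\<bar>ak k (\<gamma> s) / a (\<gamma> s)\<bar> \<le> p k" and a: "0 < a (\<gamma> s)"
      using \<gamma>S[of s] good[of "\<gamma> s"] a_ge[of "\<gamma> s"] alpha k by (auto simp: S_def)
    then have "\<bar>ak k (\<gamma> s)\<bar> \<le> p k * a (\<gamma> s)" by (simp add: field_simps)
    then show "\<bar>c k s\<bar> \<le> p k * ((\<Sum>j\<in>I. c j s) - lam)"
      by (simp add: c_def aI)
  next
    fix s
    have "0 < a (\<gamma> s)" using a_ge[OF S_t0[OF \<gamma>S]] alpha by (rule order.strict_trans2[rotated])
    then show "lam < (\<Sum>k\<in>I. c k s)" by (simp add: aI c_def)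
  qed (use finI lam in auto)
  have M1_eq: "D.M1 = M1"
    unfolding M1_def D.M1_def D.L_def by (simp add: \<beta>_def p_def ak_def I_def)
  have x_ac_T: "abs_cont_on t0 t x" if "t0 \<le> t" for t
    using x_ac that by (simp add: loc_abs_cont_from_def)
  define E where "E t = exp (lam * (t - t0))" for t
  define z where "z t = (if t < t0 then 0 else E t * x t)" for t
  define H where "H t = lam * (E t * x t) + E t * (f t - (\<Sum>k\<in>I. b k t * x (h k t)))" for t
  \<comment> \<open>Taking \<open>G\<close> as the remainder makes the integral equation for
    \<open>z\<close> immediate and leaves its size to \<open>G_le\<close>. The value zero off
    \<open>S\<close> lets the bound by \<open>g\<close> hold at every point.\<close>
  define G where "G t = (if t \<in> S then H t - D.rhs z t else 0)" for t
  define g where "g t = E t * F + (\<Sum>k\<in>I. \<beta> k * \<Phi> * (if t < t0 + \<tau>k k then E t else 0))" for t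
  have zcont: "continuous_on {t0..} z"
  proof (rule continuous_on_atLeast)
    fix t
    show "continuous_on {t0..t} z"
    proof (cases "t0 \<le> t")
      case True
      then have "continuous_on {t0..t} (\<lambda>t. E t * x t)"
        unfolding E_def by (intro continuous_intros abs_cont_on_imp_continuous_on x_ac_T)
      then show ?thesis by (rule continuous_on_eq) (auto simp: z_def)
    qed auto
  qed
  have zmeas: "z \<in> borel_measurable borel"
    by (rule measurable_if_continuous_from[OF zcont]) (simp add: z_def)
  obtain K where K: "\<And>t. t \<le> T \<Longrightarrow> \<bar>z t\<bar> \<le> K"
  proof -
    have "continuous_on {t0..T} z" using zcont by (rule continuous_on_subset) auto
    then have "bounded (z ` {t0..T})"
      by (intro compact_imp_bounded compact_continuous_image) auto
    then obtain K where "K > 0" and "\<And>t. t \<in> {t0..T} \<Longrightarrow> \<bar>z t\<bar> \<le> K"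
      unfolding bounded_pos by auto
    then have "\<bar>z t\<bar> \<le> K" if "t \<le> T" for t
      using that by (cases "t < t0") (auto simp: z_def)
    then show thesis by (rule that)
  qed
  have Hint: "(H has_integral (E t * x t - x t0)) {t0..t}" if t: "t0 \<le> t" for t
  proof -
    have "abs_cont_on t0 t (\<lambda>t. E t * x t)"
      by (rule abs_cont_on_mult_lipschitz[OF x_ac_T[OF t]])
        (unfold E_def, rule abs_exp_diff_le[OF lam])
    then have "(H has_integral (E t * x t - E t0 * x t0)) {t0..t}"
    proof (rule abs_cont_on_has_integral[OF t _ negN])
      fix s assume s: "s \<in> {t0..t} - N"
      then have "(x has_real_derivative (f s - (\<Sum>k\<in>I. b k s * x (h k s)))) (at s)"
        using good[of s] by (auto simp: I_def)
      moreover have "(E has_real_derivative lam * E s) (at s)"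
        unfolding E_def[abs_def] by (auto intro!: derivative_eq_intros)
      ultimately show "((\<lambda>t. E t * x t) has_real_derivative H s) (at s)"
        by (auto intro!: derivative_eq_intros simp: H_def)
    qed
    then show ?thesis by (simp add: E_def)
  qed
  have rhs_int: "D.rhs z integrable_on {t0..t}" if "t \<le> T" for t
    by (rule D.rhs_integrable[OF zmeas, of t K]) (use K that in auto)
  have Gint: "(G has_integral (E t * x t - x t0 - integral {t0..t} (D.rhs z))) {t0..t}"
    if "t0 \<le> t" "t \<le> T" for t
  proof (rule has_integral_spike[OF negN])
    show "((\<lambda>t. H t - D.rhs z t) has_integral (E t * x t - x t0 - integral {t0..t} (D.rhs z))) {t0..t}"
      by (intro has_integral_diff Hint that integrable_integral rhs_int)
  qed (auto simp: G_def S_def)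
  have z_eq: "z t = x t0 + integral {t0..t} (D.rhs z) + integral {t0..t} G" if "t0 \<le> t" "t \<le> T" for t
    using integral_unique[OF Gint[OF that]] that by (simp add: z_def)
  have \<Phi>: "\<bar>\<phi> s\<bar> \<le> \<Phi>" if "s \<in> {t0 - \<tau>..t0}" for s
    unfolding \<Phi>_def sup_norm_def
  proof (rule cSUP_upper[OF that])
    obtain X where "\<forall>y\<in>\<phi> ` {t0 - \<tau>..t0}. norm y \<le> X" using phi_bdd by (auto simp: bounded_iff)
    then show "bdd_above ((\<lambda>t. \<bar>\<phi> t\<bar>) ` {t0 - \<tau>..t0})" by (intro bdd_aboveI2[of _ _ X]) auto
  qed
  have \<Phi>0: "0 \<le> \<Phi>" using \<Phi>[of t0] \<tau>0 by (auto intro: order_trans[OF abs_ge_zero])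
  have E0: "0 < E t" for t by (simp add: E_def)
  have g_nonneg: "0 \<le> g t" for t
    unfolding g_def using E0[of t] F0 \<beta>0 \<Phi>0 by (intro add_nonneg_nonneg sum_nonneg mult_nonneg_nonneg) auto
  have G_le: "\<bar>G t\<bar> \<le> g t" if t: "t \<in> {t0..T}" for t
  proof (cases "t \<in> S")
    case False then show ?thesis using g_nonneg[of t] by (simp add: G_def)
  next
    case True
    then have tN: "t \<notin> N" by (simp add: S_def)
    \<comment> \<open>The part of the delayed term that reaches back before \<open>t0\<close>: there
      the truncated \<open>z\<close> vanishes and \<open>x\<close> equals
      \<open>\<phi>\<close>.\<close>
    define w where "w k = (if h k t < t0 then b k t * x (h k t) else 0)" for k
    have "c k t * z (h' k t) = E t * (b k t * x (h k t)) - E t * w k" if "k \<in> I" for k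
    proof -
      \<comment> \<open>The exponential factor in \<open>ak\<close> is what moves the weight from
        \<open>h k t\<close> to \<open>t\<close>.\<close>
      have "exp (lam * (t - h k t)) * E (h k t) = E t"
        by (simp add: E_def algebra_simps flip: exp_add)
      then show ?thesis
        using t True by (auto simp: c_def \<gamma>_def ak_def h'_def z_def w_def mult.left_commute mult.commute)
    qed
    then have "(\<Sum>k\<in>I. c k t * z (h' k t)) = E t * (\<Sum>k\<in>I. b k t * x (h k t)) - E t * (\<Sum>k\<in>I. w k)"
      by (simp add: sum_subtractf sum_distrib_left)
    then have "G t = E t * f t - E t * (\<Sum>k\<in>I. w k)"
      using True t by (simp add: G_def H_def D.rhs_def z_def algebra_simps)
    also have "\<bar>\<dots>\<bar> \<le> E t * \<bar>f t\<bar> + E t * (\<Sum>k\<in>I. \<bar>w k\<bar>)"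
      using E0[of t] by (intro order_trans[OF abs_triangle_ineq4] add_mono) (auto simp: abs_mult)
    also have "\<dots> \<le> E t * F + E t * (\<Sum>k\<in>I. \<beta> k * \<Phi> * (if t < t0 + \<tau>k k then 1 else 0))"
    proof (intro add_mono mult_left_mono sum_mono)
      show "\<bar>f t\<bar> \<le> F" using good[OF tN] t by auto
      fix k assume k: "k \<in> I"
      show "\<bar>w k\<bar> \<le> \<beta> k * \<Phi> * (if t < t0 + \<tau>k k then 1 else 0)"
      proof (cases "h k t < t0")
        case True
        have 1: "t < t0 + \<tau>k k" and "h k t \<in> {t0 - \<tau>..t0}"
          using True h_le[OF k, of t] \<tau>[OF k] t by auto
        then have "\<bar>x (h k t)\<bar> \<le> \<Phi>" using \<Phi> x_init by simp
        moreover have "\<bar>b k t\<bar> \<le> \<beta> k" using good[OF tN] k t by auto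
        ultimately have "\<bar>b k t\<bar> * \<bar>x (h k t)\<bar> \<le> \<beta> k * \<Phi>" by (intro mult_mono \<beta>0[OF k]) auto
        then show ?thesis using 1 True by (simp add: w_def abs_mult)
      next
        case False then show ?thesis using \<beta>0[OF k] \<Phi>0 by (simp add: w_def)
      qed
    qed (use E0[of t] in auto)
    also have "\<dots> = g t"
      by (simp add: g_def sum_distrib_left if_distrib[of "(*) _"] mult.commute cong: if_cong)
    finally show ?thesis .
  qed
  define P where "P t = E t / lam" for t
  have P: "(P has_real_derivative E t) (at t)" for t
    unfolding P_def[abs_def] E_def using lam by (auto intro!: derivative_eq_intros)
  have gint: "(g has_integral ((P T - P t0) * F
      + (\<Sum>k\<in>I. \<beta> k * \<Phi> * (P (min T (t0 + \<tau>k k)) - P (min t0 (t0 + \<tau>k k)))))) {t0..T}"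
    unfolding g_def[abs_def]
  proof (intro has_integral_add has_integral_sum finI has_integral_mult_right has_integral_mult_left
      has_integral_stopped[OF P T])
    show "(E has_integral (P T - P t0)) {t0..T}"
      using P by (intro fundamental_theorem_of_calculus T)
        (simp add: has_real_derivative_iff_has_vector_derivative has_vector_derivative_at_within)
  qed
  have E_mono: "s \<le> t \<Longrightarrow> E s \<le> E t" for s t using lam by (simp add: E_def)
  have g_int_le: "integral {t0..T} g \<le> E T / lam * F + (\<Sum>k\<in>I. (exp (lam * \<tau>k k) - 1) / lam * \<beta> k * \<Phi>)"
    unfolding integral_unique[OF gint]
  proof (intro add_mono sum_mono mult_right_mono F0)
    show "P T - P t0 \<le> E T / lam" using lam by (simp add: P_def E_def)
    fix k assume k: "k \<in> I"
    \<comment> \<open>Dropping the cut at \<open>T\<close> extends the integral to the whole span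
      that \<open>\<phi>\<close> can influence, which gives a constant independent of
      \<open>T\<close>.\<close>
    have "P (min T (t0 + \<tau>k k)) - P (min t0 (t0 + \<tau>k k)) \<le> P (t0 + \<tau>k k) - P t0"
      using E_mono[of "min T (t0 + \<tau>k k)" "t0 + \<tau>k k"] \<tau>[OF k] lam
      by (simp add: P_def divide_right_mono)
    also have "\<dots> = (exp (lam * \<tau>k k) - 1) / lam" by (simp add: P_def E_def diff_divide_distrib)
    finally have "\<beta> k * \<Phi> * (P (min T (t0 + \<tau>k k)) - P (min t0 (t0 + \<tau>k k)))
        \<le> \<beta> k * \<Phi> * ((exp (lam * \<tau>k k) - 1) / lam)"
      using \<beta>0[OF k] \<Phi>0 by (intro mult_left_mono) auto
    then show "\<beta> k * \<Phi> * (P (min T (t0 + \<tau>k k)) - P (min t0 (t0 + \<tau>k k)))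
        \<le> (exp (lam * \<tau>k k) - 1) / lam * \<beta> k * \<Phi>" by (simp only: ac_simps)
  qed
  \<comment> \<open>A crude pointwise bound, which controls the jump approximation and disappears in
    its limit.\<close>
  have g_bdd: "g t \<le> E T * F + (\<Sum>k\<in>I. \<beta> k * \<Phi> * E T)" if "t \<in> {t0..T}" for t
    unfolding g_def using that E_mono[of t T] E0[of t] E0[of T] F0 \<beta>0 \<Phi>0
    by (intro add_mono sum_mono mult_right_mono mult_left_mono) auto
  have "\<bar>z T\<bar> \<le> 1 / (1 - D.M1) * (\<bar>x t0\<bar> + integral {t0..T} g)"
  proof (rule D.forced_bound)
    show "D.M1 < 1" using M1_lt M1_eq by simp
    show "z t = 0" if "t < t0" for t using that by (simp add: z_def)
    show "G integrable_on {t0..T}" using Gint[OF T] by blast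
    show "g integrable_on {t0..T}" using gint by blast
    show "\<bar>G t\<bar> \<le> E T * F + (\<Sum>k\<in>I. \<beta> k * \<Phi> * E T)" if "t \<in> {t0..T}" for t
      using G_le[OF that] g_bdd[OF that] by linarith
  qed (use zmeas K z_eq G_le T in auto)
  then have "\<bar>z T\<bar> \<le> M0 * (\<bar>x t0\<bar> + integral {t0..T} g)" by (simp add: M0_def M1_eq)
  also have "\<dots> \<le> M0 * (\<bar>x t0\<bar> + (E T / lam * F + (\<Sum>k\<in>I. (exp (lam * \<tau>k k) - 1) / lam * \<beta> k * \<Phi>)))"
    using g_int_le M1_lt by (intro mult_left_mono) (auto simp: M0_def)
  \<comment> \<open>Dividing by the weight gives the initial data their exponential decay, while in
    the forcing term it cancels the factor \<open>E T\<close>.\<close>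
  finally have "\<bar>z T\<bar> / E T \<le> M0 * (\<bar>x t0\<bar> + (E T / lam * F + (\<Sum>k\<in>I. (exp (lam * \<tau>k k) - 1) / lam * \<beta> k * \<Phi>))) / E T"
    using E0[of T] by (intro divide_right_mono) auto
  also have "\<bar>z T\<bar> / E T = \<bar>x T\<bar>"
    using T E0[of T] by (simp add: z_def abs_mult)
  also have "M0 * (\<bar>x t0\<bar> + (E T / lam * F + (\<Sum>k\<in>I. (exp (lam * \<tau>k k) - 1) / lam * \<beta> k * \<Phi>))) / E T
      = M0 * (1 / E T) * (\<bar>x t0\<bar> + (\<Sum>k\<in>I. (exp (lam * \<tau>k k) - 1) / lam * \<beta> k * \<Phi>)) + M0 / lam * F"
    using E0[of T] lam by (simp add: field_simps)
  also have "1 / E T = exp (- lam * (T - t0))"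
    by (simp add: E_def exp_minus inverse_eq_divide)
  finally show "\<bar>x T\<bar> \<le> M0 * exp (- lam * (T - t0)) *
            (\<bar>x t0\<bar> + (\<Sum>k=1..m. (exp (lam * \<tau>k k) - 1) / lam * ess_norm {t0..} (b k)
                            * sup_norm {t0 - \<tau>..t0} \<phi>))
          + M0 / lam * ess_norm {t0..T} f"
    by (simp only: \<beta>_def \<Phi>_def F_def I_def)
qed

end
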